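(* Assume that $\Gamma$ is a bidirected tree. Then each monomial of the graph Laurent phenomenon algebra $\mathcal{A}_\Gamma$, i.e. each element of the form $\prod_{v\in U}X_v\prod_{I\in\mathcal{S}}Y_I$ with $U$ a finite multiset of elements of $V$ and $\mathcal{S}$ a finite multiset of subsets of $V$, is a linear combination of cluster monomials over $R$ with nonnegative coefficients.
   Context: Graph. $\Gamma$ is a finite directed graph with vertex set $V$ and edge set $E$, without loops or multiple edges. It is a bidirected tree if $(u,v)\in E\iff(v,u)\in E$ and the underlying undirected graph is a tree. Ring. $R$ is a commutative ring containing elements $A_v$ ($v\in V$) algebraically independent over $\mathbb{Z}$ (for example $R=\mathbb{Z}[A_v : v\in V]$). $\mathcal{L}=R[X_v^{\pm1}: v\in V]$ is the Laurent polynomial ring. A coefficient in $R$ is called nonnegative if it is a polynomial in the $A_v$ with nonnegative integer coefficients. $Y$-elements. For $I\subset V$, a function on $I$ is a map $f:I\to V$ such that for every $v\in I$ either $f(v)=v$ or $(v,f(v))\in E$. It is acyclic if the directed graph with edges $(v,f(v))$, $v\in I$, has no directed cycles other than loops. Put $\tilde X_{(v,w)}=X_w$ if $w\ne v$ and $\tilde X_{(v,v)}=A_v$. Define $$Y_I=\sum_{f}\ \prod_{v\in I}\frac{\tilde X_{(v,f(v))}}{X_v}\in\mathcal{L},$$ the sum being over all acyclic functions $f$ on $I$ (so $Y_\varnothing=1$). Algebra. A set $I\subset V$ is strongly connected if for all $u,v\in I$ there is a directed path from $u$ to $v$ contained in $I$. $\mathcal{A}_\Gamma$ is the $R$-subalgebra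 of $\mathcal{L}$ generated by all $X_v$ ($v\in V$) and all $Y_I$ with $I\subset V$ strongly connected (all $Y_I$, $I\subset V$, lie in it). Nested multicollections. The strongly connected components of $U\subset V$ are the maximal nonempty strongly connected subsets of $U$. A nested collection is a set $\mathcal{N}$ of nonempty subsets of $V$ such that (1) for all $I,J\in\mathcal{N}$, $I\subset J$ or $J\subset I$ or $I\cap J=\varnothing$; and (2) for any $\mathcal{R}\subset\mathcal{N}$ whose distinct elements are pairwise disjoint, each $I\in\mathcal{R}$ is a strongly connected component of $\bigcup_{J\in\mathcal{R}}J$. A nested multicollection is a finite multiset of nonempty subsets of $V$ whose underlying set is a nested collection. Cluster monomials. A cluster monomial is an element $\prod_{v\in U}X_v\prod_{I\in\mathcal{N}}Y_I$ (products with multiplicity), where $U$ is a finite multiset of vertices and $\mathcal{N}$ is a nested multicollection all of whose members are disjoint from the support of $U$. *)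

theory Defs
  imports
    "Graph_Theory.Graph_Theory"
    "HOL-Library.Multiset"
    "HOL-Library.FuncSet"
    "HOL-Library.Poly_Mapping"
begin

section \<open>Bidirected trees and strongly connected components\<close>

text \<open>
  The library predicate \<^const>\<open>tree\<close> is unsuitable here: in a symmetric digraph the walk
  \<open>u, v, u\<close> counts as a directed cycle. The cycles of the underlying undirected graph are the
  directed cycles of length at least three.
\<close>

definition bidirected_tree :: "('v, 'e) pre_digraph \<Rightarrow> bool" where
  "bidirected_tree G \<longleftrightarrow>
     digraph G \<and> symmetric G \<and> connected G \<and>
     \<not> (\<exists>p. pre_digraph.cycle G p \<and> length p \<ge> 3)"

definition strong_components :: "('v, 'e) pre_digraph \<Rightarrow> 'v set \<Rightarrow> 'v set set" where
  "strong_components G U = verts ` pre_digraph.sccs (G \<restriction> U)"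


section \<open>The coefficient ring\<close>

definition eval_int_poly ::
    "('v \<Rightarrow> 'r) \<Rightarrow> (('v \<Rightarrow>\<^sub>0 nat) \<Rightarrow>\<^sub>0 int) \<Rightarrow> 'r::comm_ring_1" where
  "eval_int_poly A P =
     (\<Sum>m\<in>Poly_Mapping.keys P.
        of_int (Poly_Mapping.lookup P m) *
        (\<Prod>v\<in>Poly_Mapping.keys m. A v ^ Poly_Mapping.lookup m v))"

definition int_poly_in :: "'v set \<Rightarrow> (('v \<Rightarrow>\<^sub>0 nat) \<Rightarrow>\<^sub>0 int) \<Rightarrow> bool" where
  "int_poly_in V P \<longleftrightarrow> (\<forall>m\<in>Poly_Mapping.keys P. Poly_Mapping.keys m \<subseteq> V)"

definition alg_independent_over_int :: "'v set \<Rightarrow> ('v \<Rightarrow> 'r::comm_ring_1) \<Rightarrow> bool" where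
  "alg_independent_over_int V A \<longleftrightarrow>
     (\<forall>P. int_poly_in V P \<longrightarrow> eval_int_poly A P = 0 \<longrightarrow> P = 0)"

definition nonneg_coeff :: "'v set \<Rightarrow> ('v \<Rightarrow> 'r::comm_ring_1) \<Rightarrow> 'r \<Rightarrow> bool" where
  "nonneg_coeff V A r \<longleftrightarrow>
     (\<exists>P. int_poly_in V P \<and> (\<forall>m. 0 \<le> Poly_Mapping.lookup P m) \<and> r = eval_int_poly A P)"


section \<open>Laurent polynomials\<close>

text \<open>
  The Laurent polynomial ring is the group ring of the free abelian group of exponent vectors.
  There is a variable for every element of the type \<open>'v\<close>, but only those indexed by vertices of
  the graph are used below.
\<close>

type_synonym ('v, 'r) laurent = "('v \<Rightarrow>\<^sub>0 int) \<Rightarrow>\<^sub>0 'r"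

definition lconst :: "'r::comm_ring_1 \<Rightarrow> ('v, 'r) laurent" where
  "lconst r = Poly_Mapping.single 0 r"

definition X :: "'v \<Rightarrow> ('v, 'r::comm_ring_1) laurent" where
  "X v = Poly_Mapping.single (Poly_Mapping.single v 1) 1"

definition X_inv :: "'v \<Rightarrow> ('v, 'r::comm_ring_1) laurent" where
  "X_inv v = Poly_Mapping.single (Poly_Mapping.single v (- 1)) 1"

lemma X_times_X_inv: "X v * X_inv v = 1"
  by (simp add: X_def X_inv_def mult_single flip: single_add)


section \<open>The elements \<open>Y\<close>\<close>

definition acyclic_functions :: "('v, 'e) pre_digraph \<Rightarrow> 'v set \<Rightarrow> ('v \<Rightarrow> 'v) set" where
  "acyclic_functions G I =
     {f \<in> I \<rightarrow>\<^sub>E verts G.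
        (\<forall>v\<in>I. f v = v \<or> v \<rightarrow>\<^bsub>G\<^esub> f v) \<and>
        acyclic {(v, f v) | v. v \<in> I \<and> f v \<noteq> v}}"

definition X_tilde :: "('v \<Rightarrow> 'r) \<Rightarrow> 'v \<Rightarrow> 'v \<Rightarrow> ('v, 'r::comm_ring_1) laurent" where
  "X_tilde A v w = (if w = v then lconst (A v) else X w)"

definition Y :: "('v, 'e) pre_digraph \<Rightarrow> ('v \<Rightarrow> 'r) \<Rightarrow> 'v set \<Rightarrow> ('v, 'r::comm_ring_1) laurent" where
  "Y G A I = (\<Sum>f\<in>acyclic_functions G I. \<Prod>v\<in>I. X_tilde A v (f v) * X_inv v)"

lemma Y_empty: "Y G A {} = 1"
  by (simp add: Y_def acyclic_functions_def acyclic_def)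


section \<open>Cluster monomials\<close>

definition nested_collection :: "('v, 'e) pre_digraph \<Rightarrow> 'v set set \<Rightarrow> bool" where
  "nested_collection G N \<longleftrightarrow>
     (\<forall>I\<in>N. I \<noteq> {} \<and> I \<subseteq> verts G) \<and>
     (\<forall>I\<in>N. \<forall>J\<in>N. I \<subseteq> J \<or> J \<subseteq> I \<or> I \<inter> J = {}) \<and>
     (\<forall>R\<subseteq>N. pairwise disjnt R \<longrightarrow> R \<subseteq> strong_components G (\<Union>R))"

definition nested_multicollection :: "('v, 'e) pre_digraph \<Rightarrow> 'v set multiset \<Rightarrow> bool" where
  "nested_multicollection G N \<longleftrightarrow> nested_collection G (set_mset N)"

definition monomial ::
    "('v, 'e) pre_digraph \<Rightarrow> ('v \<Rightarrow> 'r) \<Rightarrow> 'v multiset \<Rightarrow> 'v set multiset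
      \<Rightarrow> ('v, 'r::comm_ring_1) laurent" where
  "monomial G A U S = (\<Prod>v\<in>#U. X v) * (\<Prod>I\<in>#S. Y G A I)"

definition cluster_monomials ::
    "('v, 'e) pre_digraph \<Rightarrow> ('v \<Rightarrow> 'r) \<Rightarrow> ('v, 'r::comm_ring_1) laurent set" where
  "cluster_monomials G A =
     {monomial G A U N | U N.
        set_mset U \<subseteq> verts G \<and> nested_multicollection G N \<and>
        (\<forall>I\<in>#N. I \<inter> set_mset U = {})}"

end

theory Submission
  imports Defs
begin

text \<open>
  In a tree the only cycles that an otherwise acyclic function can close are those of length two, so
  \<open>Y\<close> satisfies the recurrence \<open>Y I = Y {a} Y (I - {a}) - (\<Sum>c. Y (I - {a, c}))\<close>, the sum being over
  the neighbours \<open>c\<close> of \<open>a\<close> in \<open>I\<close>: up to conjugation, \<open>Y I\<close> is the principal minor at \<open>I\<close> of a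
  diagonal matrix minus the adjacency matrix. The recurrence alone yields the positive identity
  \<open>Y I Y J = (\<Sum>P. Y (I \<union> J - P) Y (I \<inter> J - P))\<close>, where \<open>P\<close> runs over the systems of
  disjoint paths from \<open>I - J\<close> to \<open>J - I\<close> through \<open>I \<inter> J\<close>, and a positive expansion of \<open>X v Y I\<close> for
  \<open>v \<in> I\<close> in which \<open>I\<close> is replaced by proper subsets. Rewriting with these identities decreases
  \<open>\<Sum>I. |I| (2 |V| + 1 - |I|)\<close>, and it stops when the sets \<open>I\<close> form a chain and avoid all \<open>v\<close>. The strongly
  connected components of the members of a chain form a nested collection, and each \<open>Y I\<close> is the
  product over the components of \<open>I\<close>.
\<close>

section \<open>Paths and linkages\<close>

text \<open>
  A path that stays in \<open>H\<close> until it stops in \<open>T\<close>. Since the current vertex is deleted from \<open>H\<close>, the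
  path is self-avoiding as long as \<open>H\<close> and \<open>T\<close> are disjoint.
\<close>

inductive exit_path :: "('v \<Rightarrow> 'v \<Rightarrow> bool) \<Rightarrow> 'v set \<Rightarrow> 'v set \<Rightarrow> 'v \<Rightarrow> 'v list \<Rightarrow> bool"
  for adj T where
  stop: "c \<in> T \<Longrightarrow> exit_path adj T H c [c]"
| step: "c \<in> H \<Longrightarrow> adj c d \<Longrightarrow> exit_path adj T (H - {c}) d q \<Longrightarrow> exit_path adj T H c (c # q)"

definition exit_paths :: "('v \<Rightarrow> 'v \<Rightarrow> bool) \<Rightarrow> 'v set \<Rightarrow> 'v set \<Rightarrow> 'v \<Rightarrow> 'v list set" where
  "exit_paths adj T H c = {p. exit_path adj T H c p}"

lemma exit_path_not_Nil: "exit_path adj T H c p \<Longrightarrow> p \<noteq> []"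
  by (auto elim: exit_path.cases)

lemma exit_path_start: "exit_path adj T H c p \<Longrightarrow> c \<in> H \<union> T \<and> c \<in> set p"
  by (auto elim: exit_path.cases)

lemma exit_path_subset: "exit_path adj T H c p \<Longrightarrow> set p \<subseteq> H \<union> T"
  by (induction rule: exit_path.induct) auto

lemma exit_paths_empty: "exit_paths adj {} H c = {}"
proof -
  have "exit_path adj T H c p \<Longrightarrow> T \<noteq> {}" for T p
    by (induction rule: exit_path.induct) auto
  then show ?thesis by (auto simp: exit_paths_def)
qed

lemma exit_paths_outside: "c \<notin> H \<union> T \<Longrightarrow> exit_paths adj T H c = {}"
  by (auto simp: exit_paths_def dest: exit_path_start)

lemma exit_paths_stop: "c \<in> T \<Longrightarrow> c \<notin> H \<Longrightarrow> exit_paths adj T H c = {[c]}"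
  by (auto simp: exit_paths_def intro: stop elim: exit_path.cases)

lemma exit_paths_step:
  assumes "c \<in> H" "c \<notin> T"
  shows "exit_paths adj T H c =
    (\<Union>d\<in>{d \<in> (H - {c}) \<union> T. adj c d}. (#) c ` exit_paths adj T (H - {c}) d)"
proof -
  have "exit_path adj T H c p \<longleftrightarrow> (\<exists>d q. d \<in> (H - {c}) \<union> T \<and> adj c d \<and> p = c # q \<and>
      exit_path adj T (H - {c}) d q)" (is "_ \<longleftrightarrow> ?r p") for p
  proof
    assume "exit_path adj T H c p"
    then show "?r p" using assms by cases (auto dest: exit_path_start)
  qed (use assms in \<open>auto intro: exit_path.step\<close>)
  then show ?thesis by (auto simp: exit_paths_def)
qed

lemma finite_exit_paths:
  assumes "finite H" "finite T" "H \<inter> T = {}"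
  shows "finite (exit_paths adj T H c)"
  using assms
proof (induction "card H" arbitrary: H c)
  case (0 H c)
  then show ?case
    by (cases "c \<in> T") (auto simp: exit_paths_stop exit_paths_outside)
next
  case (Suc n H c)
  show ?case
  proof (cases "c \<in> H")
    case True
    have "n = card (H - {c})" using Suc.hyps(2) Suc.prems True by simp
    then have "finite (exit_paths adj T (H - {c}) d)" for d
      using Suc.prems by (intro Suc.hyps(1)) auto
    moreover have "c \<notin> T" using Suc.prems True by auto
    ultimately show ?thesis using True Suc.prems by (simp add: exit_paths_step)
  next
    case False
    then show ?thesis
      by (cases "c \<in> T") (auto simp: exit_paths_stop exit_paths_outside)
  qed
qed

lemma sum_exit_paths_step:
  fixes g :: "'v list \<Rightarrow> 'r::comm_ring_1"
  assumes "finite H" "finite T" "H \<inter> T = {}" "c \<in> H"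
  shows "(\<Sum>p\<in>exit_paths adj T H c. g p) =
    (\<Sum>d | d \<in> (H - {c}) \<union> T \<and> adj c d. \<Sum>q\<in>exit_paths adj T (H - {c}) d. g (c # q))"
proof -
  have "c \<notin> T" using assms by auto
  have hd: "p \<in> exit_paths adj T H d \<Longrightarrow> hd p = d" for p d and H :: "'v set"
    by (auto simp: exit_paths_def elim: exit_path.cases)
  have "(\<Sum>p\<in>exit_paths adj T H c. g p) =
      (\<Sum>d\<in>{d \<in> (H - {c}) \<union> T. adj c d}. \<Sum>p\<in>(#) c ` exit_paths adj T (H - {c}) d. g p)"
    unfolding exit_paths_step[OF \<open>c \<in> H\<close> \<open>c \<notin> T\<close>]
    using assms by (intro sum.UNION_disjoint) (auto intro!: finite_exit_paths dest: hd)
  also have "\<dots> = (\<Sum>d\<in>{d \<in> (H - {c}) \<union> T. adj c d}. \<Sum>q\<in>exit_paths adj T (H - {c}) d. g (c # q))"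
    by (intro sum.cong[OF refl]) (simp add: sum.reindex)
  finally show ?thesis by simp
qed

lemma exit_path_avoid:
  "exit_path adj T H c p \<Longrightarrow> set p \<inter> Q = {} \<Longrightarrow> exit_path adj (T - Q) (H - Q) c p"
proof (induction rule: exit_path.induct)
  case (step c H d q)
  moreover have "H - {c} - Q = H - Q - {c}" by auto
  ultimately show ?case by (auto intro!: exit_path.step)
qed (auto intro: exit_path.stop)

lemma exit_path_mono:
  "exit_path adj T H c p \<Longrightarrow> T \<subseteq> T' \<Longrightarrow> H \<subseteq> H' \<Longrightarrow> exit_path adj T' H' c p"
proof (induction arbitrary: H' rule: exit_path.induct)
  case (step c H d q)
  then show ?case by (intro exit_path.step[of c _ _ d]) (auto intro!: step.IH)
qed (auto intro: exit_path.stop)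

text \<open>Avoiding vertices amounts to deleting them from the instance, so a sum over paths
  disjoint from a given linkage is again a sum over all paths, for smaller sets.\<close>

lemma exit_paths_avoid:
  "{p \<in> exit_paths adj T H c. set p \<inter> Q = {}} = exit_paths adj (T - Q) (H - Q) c"
proof -
  have "set p \<inter> Q = {}" "exit_path adj T H c p" if "exit_path adj (T - Q) (H - Q) c p" for p
    using exit_path_subset[OF that] exit_path_mono[OF that] by auto
  then show ?thesis by (auto simp: exit_paths_def intro: exit_path_avoid)
qed

lemma exit_paths_Un:
  "exit_paths adj (T1 \<union> T2) H c = exit_paths adj T1 H c \<union> exit_paths adj T2 H c"
proof -
  have "exit_path adj (T1 \<union> T2) H c p \<Longrightarrow> exit_path adj T1 H c p \<or> exit_path adj T2 H c p" for p
    by (induction rule: exit_path.induct) (auto intro: exit_path.intros)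
  then show ?thesis by (auto simp: exit_paths_def intro: exit_path_mono)
qed

text \<open>A path ends in its target set, so the two families are told apart by their last
  vertices.\<close>

lemma exit_paths_disjoint:
  assumes "T1 \<inter> T2 = {}"
  shows "exit_paths adj T1 H c \<inter> exit_paths adj T2 H c = {}"
proof -
  have "exit_path adj T H c p \<Longrightarrow> last p \<in> T" for T p
    by (induction rule: exit_path.induct) (auto dest: exit_path_not_Nil)
  then show ?thesis using assms unfolding exit_paths_def by blast
qed

section \<open>Linkages: systems of disjoint paths\<close>

text \<open>The source \<open>a\<close> is inserted into \<open>H\<close> to permit the first step.
  If \<open>L\<close> is disjoint from \<open>H\<close> and \<open>R\<close>, no other source is
  ever visited.\<close>

definition links :: "('v \<Rightarrow> 'v \<Rightarrow> bool) \<Rightarrow> 'v set \<Rightarrow> 'v set \<Rightarrow> 'v set \<Rightarrow> 'v list set" where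
  "links adj L H R = (\<Union>a\<in>L. exit_paths adj R (insert a H) a)"

definition support :: "'v list set \<Rightarrow> 'v set" where
  "support P = (\<Union>p\<in>P. set p)"

definition linkages :: "('v \<Rightarrow> 'v \<Rightarrow> bool) \<Rightarrow> 'v set \<Rightarrow> 'v set \<Rightarrow> 'v set \<Rightarrow> 'v list set set" where
  "linkages adj L H R =
    {P. P \<subseteq> links adj L H R \<and> pairwise (\<lambda>p q. set p \<inter> set q = {}) P}"

lemma linkages_no_source: "linkages adj {} H R = {{}}"
  by (auto simp: linkages_def links_def)

lemma finite_linkages:
  assumes "finite L" "finite H" "finite R" "(L \<union> H) \<inter> R = {}"
  shows "finite (linkages adj L H R)"
proof -
  have "finite (links adj L H R)"
    using assms unfolding links_def by (auto intro!: finite_exit_paths)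
  then show ?thesis unfolding linkages_def by simp
qed

lemma links_avoid: "{p \<in> links adj L H R. set p \<inter> Q = {}} = links adj (L - Q) (H - Q) (R - Q)"
proof -
  have "{p \<in> exit_paths adj R (insert a H) a. set p \<inter> Q = {}} =
      (if a \<in> Q then {} else exit_paths adj (R - Q) (insert a (H - Q)) a)" for a
  proof (cases "a \<in> Q")
    case True
    then show ?thesis by (auto simp: exit_paths_def dest: exit_path_start)
  next
    case False
    then have "insert a H - Q = insert a (H - Q)" by auto
    with False show ?thesis by (simp add: exit_paths_avoid)
  qed
  then have "(\<Union>a\<in>L. {p \<in> exit_paths adj R (insert a H) a. set p \<inter> Q = {}}) =
      (\<Union>a\<in>L - Q. exit_paths adj (R - Q) (insert a (H - Q)) a)"
    by auto
  moreover have "{p \<in> links adj L H R. set p \<inter> Q = {}} =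
      (\<Union>a\<in>L. {p \<in> exit_paths adj R (insert a H) a. set p \<inter> Q = {}})"
    by (auto simp: links_def)
  ultimately show ?thesis by (simp add: links_def)
qed

lemma linkages_avoid:
  "{P \<in> linkages adj L H R. support P \<inter> Q = {}} = linkages adj (L - Q) (H - Q) (R - Q)"
  unfolding linkages_def links_avoid[symmetric] support_def by blast

lemma links_subset: "p \<in> links adj L H R \<Longrightarrow> set p \<subseteq> L \<union> H \<union> R"
  by (auto simp: links_def exit_paths_def dest!: exit_path_subset)

lemma support_subset: "P \<in> linkages adj L H R \<Longrightarrow> support P \<subseteq> L \<union> H \<union> R"
  by (auto simp: linkages_def support_def dest: links_subset)

text \<open>Exactly one link of such a linkage contains \<open>a\<close>, and it starts there: apart
  from its source, a link lies in \<open>H\<close> and \<open>R\<close>, and both miss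
  \<open>a\<close>. Taking this link away leaves an arbitrary linkage of the instance without its
  vertices.\<close>

lemma sum_linkages_through:
  fixes f :: "'v set \<Rightarrow> 'r::comm_ring_1"
  assumes "finite L" "finite H" "finite R" "L \<inter> H = {}" "(L \<union> H) \<inter> R = {}" "a \<in> L"
  shows "(\<Sum>P | P \<in> linkages adj L H R \<and> a \<in> support P. f (support P)) =
    (\<Sum>p\<in>exit_paths adj R (insert a H) a.
       \<Sum>P\<in>linkages adj (L - set p) (H - set p) (R - set p). f (set p \<union> support P))"
proof -
  let ?S = "SIGMA p:exit_paths adj R (insert a H) a. linkages adj (L - set p) (H - set p) (R - set p)"
  have mem: "a \<in> set p" if "p \<in> exit_paths adj R (insert a H) a" for p
    using that by (auto simp: exit_paths_def dest: exit_path_start)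
  have av: "set q \<inter> set p = {}" if "P \<in> linkages adj (L - set p) (H - set p) (R - set p)" "q \<in> P" for p q P
    using that unfolding linkages_avoid[symmetric] support_def by auto
  have inj: "inj_on (\<lambda>(p, P). insert p P) ?S"
  proof (rule inj_onI, clarsimp)
    fix p P p' P'
    assume a: "p \<in> exit_paths adj R (insert a H) a" "p' \<in> exit_paths adj R (insert a H) a"
      "P \<in> linkages adj (L - set p) (H - set p) (R - set p)"
      "P' \<in> linkages adj (L - set p') (H - set p') (R - set p')" "insert p P = insert p' P'"
    have np: "p \<notin> P" "p' \<notin> P'" using mem[of p] mem[of p'] av[of P p p] av[of P' p' p'] a by auto
    \<comment> \<open>Both links contain \<open>a\<close>, while distinct members of a linkage are
      disjoint.\<close>
    have "p = p'"
    proof (rule ccontr)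
      assume "p \<noteq> p'"
      then have "p \<in> P'" using a(5) by auto
      then have "set p \<inter> set p' = {}" using av a(4) by blast
      then show False using mem a(1,2) by blast
    qed
    then show "p = p' \<and> P = P'" using a(5) np by (metis insert_ident)
  qed
  have img: "(\<lambda>(p, P). insert p P) ` ?S = {P \<in> linkages adj L H R. a \<in> support P}" (is "?l = ?r")
  proof (intro equalityI subsetI)
    fix P assume "P \<in> ?l"
    then obtain p P' where p: "p \<in> exit_paths adj R (insert a H) a" and P: "P = insert p P'"
      and P': "P' \<in> linkages adj (L - set p) (H - set p) (R - set p)" by auto
    have "P' \<in> linkages adj L H R" using P' unfolding linkages_avoid[symmetric] by auto
    moreover have "p \<in> links adj L H R" using p \<open>a \<in> L\<close> by (auto simp: links_def)
    moreover have "set q \<inter> set p = {}" if "q \<in> P'" for q using av[OF P' that] .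
    ultimately show "P \<in> ?r" using mem[OF p]
      by (auto simp: P linkages_def support_def pairwise_insert Int_commute)
  next
    fix P assume P: "P \<in> ?r"
    then obtain p where p: "p \<in> P" "a \<in> set p" by (auto simp: support_def)
    then obtain b where b: "b \<in> L" "p \<in> exit_paths adj R (insert b H) b"
      using P by (auto simp: linkages_def links_def)
    have "set p \<subseteq> insert b H \<union> R" using b by (auto simp: exit_paths_def dest!: exit_path_subset)
    then have "b = a" using p assms by auto
    moreover have "P - {p} \<in> linkages adj (L - set p) (H - set p) (R - set p)"
      using P p unfolding linkages_avoid[symmetric]
      by (auto simp: linkages_def support_def pairwise_def)
    moreover have "P = insert p (P - {p})" using p by auto
    ultimately show "P \<in> ?l" using b by (intro image_eqI[of _ _ "(p, P - {p})"]) auto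
  qed
  have "(\<Sum>P | P \<in> linkages adj L H R \<and> a \<in> support P. f (support P)) =
      (\<Sum>(p, P)\<in>?S. f (set p \<union> support P))"
    unfolding img[symmetric] sum.reindex[OF inj]
    by (intro sum.cong refl) (auto simp: support_def)
  also have "\<dots> = (\<Sum>p\<in>exit_paths adj R (insert a H) a.
       \<Sum>P\<in>linkages adj (L - set p) (H - set p) (R - set p). f (set p \<union> support P))"
    using assms by (subst sum.Sigma) (auto intro!: finite_exit_paths finite_linkages)
  finally show ?thesis .
qed

text \<open>Since \<open>a\<close> lies in neither \<open>H\<close> nor \<open>R\<close>, the
  linkages missing \<open>a\<close> are those with \<open>a\<close> dropped from the
  sources.\<close>

lemma sum_linkages_split:
  fixes f :: "'v set \<Rightarrow> 'r::comm_ring_1"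
  assumes "finite L" "finite H" "finite R" "L \<inter> H = {}" "(L \<union> H) \<inter> R = {}" "a \<in> L"
  shows "(\<Sum>P\<in>linkages adj L H R. f (support P)) =
    (\<Sum>P\<in>linkages adj (L - {a}) H R. f (support P)) +
    (\<Sum>p\<in>exit_paths adj R (insert a H) a.
       \<Sum>P\<in>linkages adj (L - set p) (H - set p) (R - set p). f (set p \<union> support P))"
proof -
  have "H - {a} = H" "R - {a} = R" using assms by auto
  then have "{P \<in> linkages adj L H R. a \<notin> support P} = linkages adj (L - {a}) H R"
    using linkages_avoid[of adj L H R "{a}"] by auto
  moreover have "(\<Sum>P\<in>linkages adj L H R. f (support P)) =
      (\<Sum>P | P \<in> linkages adj L H R \<and> a \<notin> support P. f (support P)) +
      (\<Sum>P | P \<in> linkages adj L H R \<and> a \<in> support P. f (support P))"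
    using assms by (subst sum.union_disjoint[symmetric]) (auto intro!: finite_linkages sum.cong)
  ultimately show ?thesis by (simp add: sum_linkages_through[OF assms])
qed

section \<open>Products of solutions of the recurrence\<close>

locale vertex_recurrence =
  fixes adj :: "'v \<Rightarrow> 'v \<Rightarrow> bool"
    and D :: "'v \<Rightarrow> 'r::comm_ring_1"
    and y :: "'v set \<Rightarrow> 'r"
  assumes rec: "finite I \<Longrightarrow> a \<in> I \<Longrightarrow>
    y I = D a * y (I - {a}) - (\<Sum>c | c \<in> I - {a} \<and> adj a c. y (I - {a} - {c}))"
begin

text \<open>Expanding \<open>y I\<close> and \<open>y J\<close> at \<open>c\<close> cancels the
  \<open>D c\<close> terms and leaves differences of the same shape at the neighbours
  \<open>d\<close> of \<open>c\<close>. If \<open>d\<close> lies in both sets, induction continues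
  the path through \<open>d\<close>; if it lies in only one, the path stops there. The side on which
  the path leaves \<open>I \<inter> J\<close> determines the sign.\<close>

lemma exchange:
  assumes "finite I" "finite J" "c \<in> I" "c \<in> J"
  shows "y I * y (J - {c}) - y (I - {c}) * y J =
    (\<Sum>p\<in>exit_paths adj (J - I) (I \<inter> J) c. y (I - set p) * y (J - set p)) -
    (\<Sum>p\<in>exit_paths adj (I - J) (I \<inter> J) c. y (I - set p) * y (J - set p))"
  using assms
proof (induction "card I" arbitrary: I J c)
  case 0
  then show ?case by simp
next
  case (Suc n I J c)
  define I' where "I' = I - {c}"
  define J' where "J' = J - {c}"
  note fin = Suc.prems(1,2)
  have fin': "finite I'" "finite J'" using fin by (auto simp: I'_def J'_def)
  have sets: "J' - I' = J - I" "I' - J' = I - J" "I' \<inter> J' = I \<inter> J - {c}"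
    using Suc.prems by (auto simp: I'_def J'_def)
  have Un: "J' = (I \<inter> J - {c}) \<union> (J - I)" "I' = (I \<inter> J - {c}) \<union> (I - J)"
    using Suc.prems by (auto simp: I'_def J'_def)
  define h where "h q = y (I' - set q) * y (J' - set q)" for q
  have h: "y (I - set (c # q)) * y (J - set (c # q)) = h q" for q
  proof -
    have "I - set (c # q) = I' - set q" "J - set (c # q) = J' - set q"
      by (auto simp: I'_def J'_def)
    then show ?thesis by (simp only: h_def)
  qed
  define A where "A d = (\<Sum>q\<in>exit_paths adj (J' - I') (I' \<inter> J') d. h q)" for d
  define B where "B d = (\<Sum>q\<in>exit_paths adj (I' - J') (I' \<inter> J') d. h q)" for d
  have sA: "(\<Sum>p\<in>exit_paths adj (J - I) (I \<inter> J) c. y (I - set p) * y (J - set p)) =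
      (\<Sum>d | d \<in> J' \<and> adj c d. A d)"
    by (subst sum_exit_paths_step) (use Suc.prems in \<open>auto simp only: h A_def[abs_def] sets Un(1)[symmetric]\<close>)
  have sB: "(\<Sum>p\<in>exit_paths adj (I - J) (I \<inter> J) c. y (I - set p) * y (J - set p)) =
      (\<Sum>d | d \<in> I' \<and> adj c d. B d)"
    by (subst sum_exit_paths_step) (use Suc.prems in \<open>auto simp only: h B_def[abs_def] sets Un(2)[symmetric]\<close>)
  have split: "(\<Sum>d | d \<in> J' \<and> adj c d. u d) - (\<Sum>d | d \<in> I' \<and> adj c d. v d) =
      (\<Sum>d | d \<in> I' \<inter> J' \<and> adj c d. u d - v d) +
      (\<Sum>d | d \<in> J' - I' \<and> adj c d. u d) - (\<Sum>d | d \<in> I' - J' \<and> adj c d. v d)" for u v :: "'v \<Rightarrow> 'r"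
  proof -
    have "(\<Sum>d | d \<in> J' \<and> adj c d. u d) =
        (\<Sum>d | d \<in> I' \<inter> J' \<and> adj c d. u d) + (\<Sum>d | d \<in> J' - I' \<and> adj c d. u d)"
      using fin' by (subst sum.union_disjoint[symmetric]) (auto intro!: sum.cong)
    moreover have "(\<Sum>d | d \<in> I' \<and> adj c d. v d) =
        (\<Sum>d | d \<in> I' \<inter> J' \<and> adj c d. v d) + (\<Sum>d | d \<in> I' - J' \<and> adj c d. v d)"
      using fin' by (subst sum.union_disjoint[symmetric]) (auto intro!: sum.cong)
    ultimately show ?thesis by (simp add: sum_subtractf)
  qed
  have I: "y I = D c * y I' - (\<Sum>d | d \<in> I' \<and> adj c d. y (I' - {d}))"
    unfolding I'_def by (rule rec) (use Suc.prems in auto)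
  have J: "y J = D c * y J' - (\<Sum>d | d \<in> J' \<and> adj c d. y (J' - {d}))"
    unfolding J'_def by (rule rec) (use Suc.prems in auto)
  have both: "y I' * y (J' - {d}) - y (I' - {d}) * y J' = A d - B d" if "d \<in> I' \<inter> J'" for d
    unfolding A_def B_def h_def
    by (rule Suc.hyps(1)) (use Suc.hyps(2) Suc.prems fin' that in \<open>auto simp: I'_def\<close>)
  have onlyJ: "y I' * y (J' - {d}) = A d" if "d \<in> J' - I'" for d
    unfolding A_def h_def using that by (subst exit_paths_stop) auto
  have onlyI: "y (I' - {d}) * y J' = B d" if "d \<in> I' - J'" for d
    unfolding B_def h_def using that by (subst exit_paths_stop) auto
  have "y I * y J' - y I' * y J = (\<Sum>d | d \<in> J' \<and> adj c d. y I' * y (J' - {d})) -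
      (\<Sum>d | d \<in> I' \<and> adj c d. y (I' - {d}) * y J')"
    by (simp add: I J algebra_simps sum_distrib_left sum_distrib_right)
  also have "\<dots> = (\<Sum>d | d \<in> J' \<and> adj c d. A d) - (\<Sum>d | d \<in> I' \<and> adj c d. B d)"
  proof -
    have "(\<Sum>d | d \<in> I' \<inter> J' \<and> adj c d. y I' * y (J' - {d}) - y (I' - {d}) * y J') =
        (\<Sum>d | d \<in> I' \<inter> J' \<and> adj c d. A d - B d)"
      by (rule sum.cong[OF refl], rule both) simp
    moreover have "(\<Sum>d | d \<in> J' - I' \<and> adj c d. y I' * y (J' - {d})) =
        (\<Sum>d | d \<in> J' - I' \<and> adj c d. A d)"
      by (rule sum.cong[OF refl], rule onlyJ) simp
    moreover have "(\<Sum>d | d \<in> I' - J' \<and> adj c d. y (I' - {d}) * y J') =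
        (\<Sum>d | d \<in> I' - J' \<and> adj c d. B d)"
      by (rule sum.cong[OF refl], rule onlyI) simp
    ultimately show ?thesis by (simp only: split)
  qed
  finally show ?case by (simp only: sA sB I'_def J'_def)
qed

text \<open>
  Remove a vertex \<open>a\<close> of \<open>I - J\<close> by the recurrence. A neighbour \<open>c\<close> of \<open>a\<close> in \<open>J - I\<close> occurs only on the
  right and cancels against the linkages that use the link \<open>[a, c]\<close>. For a neighbour \<open>c\<close> in \<open>I \<inter> J\<close>,
  the lemma \<open>exchange\<close>, applied once to the left-hand side and once to each summand on the right,
  produces the same sum over the paths from \<open>c\<close> to \<open>I - J\<close> on both sides.
\<close>

theorem mult_eq_sum_linkages:
  assumes "finite I" "finite J"
  shows "y I * y J = (\<Sum>P\<in>linkages adj (I - J) (I \<inter> J) (J - I).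
    y (I \<union> J - support P) * y (I \<inter> J - support P))"
  using assms
proof (induction "card I + card J" arbitrary: I J rule: less_induct)
  case (less I J)
  show ?case
  proof (cases "I - J = {}")
    case True
    then have "I \<union> J = J" "I \<inter> J = I" by auto
    then show ?thesis by (simp add: True linkages_no_source support_def mult.commute)
  next
    case False
    then obtain a where a: "a \<in> I" "a \<notin> J" by auto
    define I' where "I' = I - {a}"
    define L where "L = I' - J"
    define H where "H = I \<inter> J"
    define R where "R = J - I"
    define U where "U = I' \<union> J"
    note defs = I'_def L_def H_def R_def U_def
    have fin: "finite I'" "finite L" "finite H" "finite R" "finite U" "finite J"
      using less.prems by (auto simp: defs)
    have disj: "L \<inter> H = {}" "(L \<union> H) \<inter> R = {}" by (auto simp: defs)
    have IH: "y K * y M = (\<Sum>P\<in>linkages adj (K - M) (K \<inter> M) (M - K).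
        y (K \<union> M - support P) * y (K \<inter> M - support P))" if "K \<subseteq> I'" "M \<subseteq> J" for K M
    proof (rule less.hyps)
      have "card K < card I" using that a less.prems by (intro psubset_card_mono) (auto simp: defs)
      moreover have "card M \<le> card J" using that fin by (intro card_mono)
      ultimately show "card K + card M < card I + card J" by simp
    qed (use that fin finite_subset in blast)+
    \<comment> \<open>\<open>g q\<close> is the product left after deleting the path
      \<open>q\<close> from \<open>I'\<close> and \<open>J\<close>. \<open>T c\<close> collects the
      terms in which the recurrence at \<open>a\<close> removes \<open>c\<close>; \<open>E c\<close>
      and \<open>F c\<close> collect the paths from \<open>c\<close> that end in \<open>R\<close>
      and in \<open>L\<close>.\<close>
    define g where "g q = y (I' - set q) * y (J - set q)" for q
    define T where "T c = (\<Sum>P\<in>linkages adj (L - {c}) (H - {c}) (R - {c}).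
        y (U - support P - {c}) * y (H - support P))" for c
    define E where "E c = (\<Sum>q\<in>exit_paths adj R H c. g q)" for c
    define F where "F c = (\<Sum>q\<in>exit_paths adj L H c. g q)" for c
    \<comment> \<open>The linkages disjoint from \<open>q\<close> are those of the pair
      \<open>I' - set q\<close>, \<open>J - set q\<close>, and the induction hypothesis sums them to
      \<open>g q\<close>.\<close>
    have g: "(\<Sum>P\<in>linkages adj (L - set q) (H - set q) (R - set q).
        y (U - (set q \<union> support P)) * y (H - (set q \<union> support P))) = g q" for q
    proof -
      have "I' - set q - (J - set q) = L - set q" "(I' - set q) \<inter> (J - set q) = H - set q"
        "J - set q - (I' - set q) = R - set q" "(I' - set q) \<union> (J - set q) = U - set q"
        using a by (auto simp: defs)
      then show ?thesis using IH[of "I' - set q" "J - set q"] by (auto simp: g_def Diff_Un Diff_Int_distrib2 set_diff_eq Int_def conj_commute conj_left_commute)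
    qed
    \<comment> \<open>Linkages missing \<open>a\<close> give the first two terms, by the recurrence
      at \<open>a\<close> in the larger factor. Those using \<open>a\<close> give the terms
      \<open>E c\<close>, where \<open>c\<close> is the vertex after \<open>a\<close> on its
      link.\<close>
    have S: "(\<Sum>P\<in>linkages adj (I - J) (I \<inter> J) (J - I). y (I \<union> J - support P) * y (I \<inter> J - support P)) =
        D a * (y I' * y J) - (\<Sum>c | c \<in> U \<and> adj a c. T c) + (\<Sum>c | c \<in> J \<and> adj a c. E c)"
    proof -
      have IJ: "I - J = insert a L" "I \<inter> J = H" "J - I = R" "I \<union> J = insert a U"
        using a by (auto simp: defs)
      have aHR: "a \<notin> H" "a \<notin> R" using a by (auto simp: defs)
      have La: "insert a L - {a} = L" using a by (auto simp: defs)
      have one: "y (insert a U - support P) = D a * y (U - support P) -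
          (\<Sum>c | c \<in> U \<and> adj a c \<and> c \<notin> support P. y (U - support P - {c}))"
        if "P \<in> linkages adj L H R" for P
      proof -
        have "a \<notin> support P" "a \<notin> U" using support_subset[OF that] a by (auto simp: defs)
        then have "insert a U - support P - {a} = U - support P" by auto
        moreover have "{c. c \<in> insert a U - support P - {a} \<and> adj a c} =
           {c. c \<in> U \<and> adj a c \<and> c \<notin> support P}" using \<open>a \<notin> U\<close> by auto
        ultimately show ?thesis
          using rec[of "insert a U - support P" a] fin \<open>a \<notin> support P\<close> by simp
      qed
      have "(\<Sum>P\<in>linkages adj L H R. y (insert a U - support P) * y (H - support P)) =
          D a * (\<Sum>P\<in>linkages adj L H R. y (U - support P) * y (H - support P)) -
          (\<Sum>P\<in>linkages adj L H R. \<Sum>c | c \<in> {c. c \<in> U \<and> adj a c} \<and> c \<notin> support P.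
            y (U - support P - {c}) * y (H - support P))"
        by (simp add: one algebra_simps sum_distrib_left sum_distrib_right sum_subtractf)
      also have "(\<Sum>P\<in>linkages adj L H R. y (U - support P) * y (H - support P)) = y I' * y J"
      proof -
        have "I' - J = L" "I' \<inter> J = H" "J - I' = R" "I' \<union> J = U" using a by (auto simp: defs)
        then show ?thesis using IH[of I' J] by simp
      qed
      \<comment> \<open>With \<open>c\<close> fixed first, the linkages missing \<open>c\<close> are
        those of the instance without \<open>c\<close>, which gives \<open>T c\<close>.\<close>
      also have "(\<Sum>P\<in>linkages adj L H R. \<Sum>c | c \<in> {c. c \<in> U \<and> adj a c} \<and> c \<notin> support P.
            y (U - support P - {c}) * y (H - support P)) =
          (\<Sum>c\<in>{c. c \<in> U \<and> adj a c}. \<Sum>P | P \<in> linkages adj L H R \<and> c \<notin> support P.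
            y (U - support P - {c}) * y (H - support P))"
        using fin disj by (intro sum.swap_restrict) (auto intro: finite_linkages)
      also have "\<dots> = (\<Sum>c | c \<in> U \<and> adj a c. T c)"
        using linkages_avoid[of adj L H R "{c}" for c] by (simp add: T_def)
      finally have first: "(\<Sum>P\<in>linkages adj L H R. y (insert a U - support P) * y (H - support P)) =
          D a * (y I' * y J) - (\<Sum>c | c \<in> U \<and> adj a c. T c)" .
      have "(\<Sum>p\<in>exit_paths adj R (insert a H) a.
           \<Sum>P\<in>linkages adj (insert a L - set p) (H - set p) (R - set p).
             y (insert a U - (set p \<union> support P)) * y (H - (set p \<union> support P))) =
          (\<Sum>p\<in>exit_paths adj R (insert a H) a. g p)"
      proof (rule sum.cong[OF refl])
        fix p assume "p \<in> exit_paths adj R (insert a H) a"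
        then have "a \<in> set p" by (auto simp: exit_paths_def dest: exit_path_start)
        then have "insert a L - set p = L - set p"
          "insert a U - (set p \<union> X) = U - (set p \<union> X)" for X by auto
        then show "(\<Sum>P\<in>linkages adj (insert a L - set p) (H - set p) (R - set p).
             y (insert a U - (set p \<union> support P)) * y (H - (set p \<union> support P))) = g p"
          by (simp only: g)
      qed
      also have "\<dots> = (\<Sum>c | c \<in> J \<and> adj a c. \<Sum>q\<in>exit_paths adj R H c. g (a # q))"
      proof -
        have "insert a H - {a} = H" "H \<union> R = J" using a by (auto simp: defs)
        then show ?thesis using a fin by (subst sum_exit_paths_step) (auto simp: defs)
      qed
      also have "\<dots> = (\<Sum>c | c \<in> J \<and> adj a c. E c)"
      proof -
        have "I' - set (a # q) = I' - set q" "J - set (a # q) = J - set q" for q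
          using a by (auto simp: defs)
        then show ?thesis by (simp only: g_def E_def)
      qed
      finally have second: "(\<Sum>p\<in>exit_paths adj R (insert a H) a.
           \<Sum>P\<in>linkages adj (insert a L - set p) (H - set p) (R - set p).
             y (insert a U - (set p \<union> support P)) * y (H - (set p \<union> support P))) =
          (\<Sum>c | c \<in> J \<and> adj a c. E c)" .
      show ?thesis
        unfolding IJ
        by (subst sum_linkages_split[where a = a and f = "\<lambda>X. y (insert a U - X) * y (H - X)"])
          (use fin disj aHR in \<open>simp_all add: La first second\<close>)
    qed
    have cL: "y (I' - {c}) * y J = T c" if "c \<in> L" for c
    proof -
      have "L - {c} = I' - {c} - J" "H - {c} = (I' - {c}) \<inter> J" "H = (I' - {c}) \<inter> J"
        "R - {c} = J - (I' - {c})" "\<And>X. U - X - {c} = (I' - {c}) \<union> J - X"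
        using a that by (auto simp: defs)
      then show ?thesis unfolding T_def by (subst IH) (auto simp only:)
    qed
    \<comment> \<open>The only path from \<open>c\<close> is \<open>[c]\<close>, so
      \<open>E c\<close> is \<open>y I' * y (J - {c})\<close>, and its expansion by the induction
      hypothesis is \<open>T c\<close>.\<close>
    have cR: "T c = E c" if "c \<in> R" for c
    proof -
      have "c \<notin> H" "I' - {c} = I'" using that by (auto simp: defs)
      then have "E c = y I' * y (J - {c})"
        using that by (simp add: E_def exit_paths_stop g_def)
      moreover have "L - {c} = I' - (J - {c})" "H - {c} = I' \<inter> (J - {c})" "H = I' \<inter> (J - {c})"
        "R - {c} = J - {c} - I'" "\<And>X. U - X - {c} = I' \<union> (J - {c}) - X"
        using a that by (auto simp: defs)
      ultimately show ?thesis unfolding T_def by (subst (asm) IH) (auto simp only:)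
    qed
    \<comment> \<open>Let \<open>Z\<close> be the sum over the linkages from \<open>L\<close> to
      \<open>R\<close> through \<open>H - {c}\<close>. Then \<open>y I' * y (J - {c})\<close> is
      \<open>Z + E c\<close> and \<open>T c\<close> is \<open>Z + E c + F c\<close>, while
      \<open>exchange\<close> gives the difference \<open>E c - F c\<close> of the two
      products.\<close>
    have cH: "y (I' - {c}) * y J = T c - E c" if c: "c \<in> H" for c
    proof -
      have cs: "c \<notin> L" "c \<notin> R" "c \<in> I'" "c \<in> J" "c \<in> U" using a c by (auto simp: defs)
      have "y I' * y (J - {c}) - y (I' - {c}) * y J = E c - F c"
      proof -
        have "J - I' = R" "I' \<inter> J = H" "I' - J = L" using a by (auto simp: defs)
        then show ?thesis using exchange[of I' J c] fin cs by (simp add: E_def F_def g_def)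
      qed
      moreover have "y I' * y (J - {c}) =
          (\<Sum>P\<in>linkages adj L (H - {c}) R. y (U - support P) * y (H - {c} - support P)) + E c"
      proof -
        \<comment> \<open>For the pair \<open>I'\<close>, \<open>J - {c}\<close> the vertex
          \<open>c\<close> becomes an additional source, and the linkages using it sum to
          \<open>E c\<close>.\<close>
        have "I' - (J - {c}) = insert c L" "I' \<inter> (J - {c}) = H - {c}"
          "J - {c} - I' = R" "I' \<union> (J - {c}) = U"
          using a c by (auto simp: defs)
        then have "y I' * y (J - {c}) = (\<Sum>P\<in>linkages adj (insert c L) (H - {c}) R.
            y (U - support P) * y (H - {c} - support P))"
          using IH[of I' "J - {c}"] by auto
        also have "\<dots> = (\<Sum>P\<in>linkages adj (insert c L - {c}) (H - {c}) R.
            y (U - support P) * y (H - {c} - support P)) +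
            (\<Sum>p\<in>exit_paths adj R (insert c (H - {c})) c.
              \<Sum>P\<in>linkages adj (insert c L - set p) (H - {c} - set p) (R - set p).
                y (U - (set p \<union> support P)) * y (H - {c} - (set p \<union> support P)))"
          by (rule sum_linkages_split) (use fin disj c in auto)
        also have "insert c L - {c} = L" using cs by auto
        also have "insert c (H - {c}) = H" using c by auto
        also have "(\<Sum>p\<in>exit_paths adj R H c.
              \<Sum>P\<in>linkages adj (insert c L - set p) (H - {c} - set p) (R - set p).
                y (U - (set p \<union> support P)) * y (H - {c} - (set p \<union> support P))) = E c"
          unfolding E_def
        proof (rule sum.cong[OF refl])
          fix p assume "p \<in> exit_paths adj R H c"
          then have "c \<in> set p" by (auto simp: exit_paths_def dest: exit_path_start)
          then have "insert c L - set p = L - set p" "H - {c} - set p = H - set p"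
            "H - {c} - (set p \<union> X) = H - (set p \<union> X)" for X by auto
          then show "(\<Sum>P\<in>linkages adj (insert c L - set p) (H - {c} - set p) (R - set p).
                y (U - (set p \<union> support P)) * y (H - {c} - (set p \<union> support P))) = g p"
            by (simp only: g)
        qed
        finally show ?thesis .
      qed
      moreover have "T c = (\<Sum>P\<in>linkages adj L (H - {c}) R.
          y (U - support P) * y (H - {c} - support P)) + E c + F c"
      proof -
        have sets: "L - {c} = L" "R - {c} = R" using cs by auto
        have fLHR: "finite (linkages adj L (H - {c}) R)" using fin disj by (auto intro!: finite_linkages)
        have "y (U - support P - {c}) * y (H - support P) =
            y (U - support P) * y (H - {c} - support P) +
            (\<Sum>q | q \<in> exit_paths adj (L \<union> R) H c \<and> set q \<inter> support P = {}.
               y (U - (set q \<union> support P)) * y (H - (set q \<union> support P)))"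
          if "P \<in> linkages adj L (H - {c}) R" for P
        proof -
          have "c \<notin> support P" using support_subset[OF that] cs by auto
          \<comment> \<open>The two sets are nested, so the negative sum of \<open>exchange\<close>
            has an empty target set. Only the paths from \<open>c\<close> to
            \<open>L \<union> R\<close> that avoid \<open>P\<close> remain.\<close>
          then have "y (H - support P) * y (U - support P - {c}) - y (H - support P - {c}) * y (U - support P) =
             (\<Sum>q\<in>exit_paths adj (U - support P - (H - support P)) ((H - support P) \<inter> (U - support P)) c.
                y (H - support P - set q) * y (U - support P - set q)) -
             (\<Sum>q\<in>exit_paths adj (H - support P - (U - support P)) ((H - support P) \<inter> (U - support P)) c.
                y (H - support P - set q) * y (U - support P - set q))"
            by (intro exchange) (use fin cs c in auto)
          moreover have "U - support P - (H - support P) = (L \<union> R) - support P"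
            "(H - support P) \<inter> (U - support P) = H - support P" "H - support P - (U - support P) = {}"
            using a by (auto simp: defs)
          moreover have "X - support P - set q = X - (set q \<union> support P)" for X q by auto
          moreover have "H - support P - {c} = H - {c} - support P" by auto
          ultimately show ?thesis
            by (simp only: exit_paths_empty exit_paths_avoid[symmetric])
               (simp add: algebra_simps)
        qed
        then have "T c = (\<Sum>P\<in>linkages adj L (H - {c}) R. y (U - support P) * y (H - {c} - support P)) +
            (\<Sum>P\<in>linkages adj L (H - {c}) R. \<Sum>q | q \<in> exit_paths adj (L \<union> R) H c \<and> set q \<inter> support P = {}.
               y (U - (set q \<union> support P)) * y (H - (set q \<union> support P)))"
          by (simp add: T_def sets sum.distrib)
        \<comment> \<open>With the path \<open>q\<close> fixed first, the linkages disjoint from it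
          again add up to \<open>g q\<close>.\<close>
        also have "(\<Sum>P\<in>linkages adj L (H - {c}) R. \<Sum>q | q \<in> exit_paths adj (L \<union> R) H c \<and> set q \<inter> support P = {}.
               y (U - (set q \<union> support P)) * y (H - (set q \<union> support P))) =
            (\<Sum>q\<in>exit_paths adj (L \<union> R) H c. \<Sum>P | P \<in> linkages adj L (H - {c}) R \<and> set q \<inter> support P = {}.
               y (U - (set q \<union> support P)) * y (H - (set q \<union> support P)))"
          using fin disj fLHR by (intro sum.swap_restrict) (auto intro!: finite_exit_paths)
        also have "\<dots> = (\<Sum>q\<in>exit_paths adj (L \<union> R) H c. g q)"
        proof (rule sum.cong[OF refl])
          fix q assume "q \<in> exit_paths adj (L \<union> R) H c"
          then have "c \<in> set q" by (auto simp: exit_paths_def dest: exit_path_start)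
          then have "H - {c} - set q = H - set q" by auto
          then have "{P \<in> linkages adj L (H - {c}) R. set q \<inter> support P = {}} =
              linkages adj (L - set q) (H - set q) (R - set q)"
            using linkages_avoid[of adj L "H - {c}" R "set q"] by (simp add: Int_commute)
          then show "(\<Sum>P | P \<in> linkages adj L (H - {c}) R \<and> set q \<inter> support P = {}.
               y (U - (set q \<union> support P)) * y (H - (set q \<union> support P))) = g q"
            by (simp only: g)
        qed
        also have "\<dots> = E c + F c"
          unfolding exit_paths_Un E_def F_def
          using fin disj by (subst sum.union_disjoint)
            (auto intro!: finite_exit_paths exit_paths_disjoint simp: add.commute)
        finally show ?thesis by (simp add: add.assoc)
      qed
      ultimately show ?thesis by (simp add: algebra_simps)
    qed
    \<comment> \<open>\<open>U\<close> splits into \<open>L\<close>, \<open>H\<close> and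
      \<open>R\<close>, and \<open>I'\<close> into \<open>L\<close> and \<open>H\<close>. The
      neighbours in \<open>R\<close> cancel because \<open>T c = E c\<close> there.\<close>
    have "(\<Sum>c | c \<in> U \<and> adj a c. T c) =
        (\<Sum>c | c \<in> L \<and> adj a c. T c) + (\<Sum>c | c \<in> J \<and> adj a c. T c)"
      using fin by (subst sum.union_disjoint[symmetric]) (auto simp: defs intro!: sum.cong)
    moreover have "(\<Sum>c | c \<in> J \<and> adj a c. u c) =
        (\<Sum>c | c \<in> H \<and> adj a c. u c) + (\<Sum>c | c \<in> R \<and> adj a c. u c)" for u :: "'v \<Rightarrow> 'r"
      using fin by (subst sum.union_disjoint[symmetric]) (auto simp: defs intro!: sum.cong)
    moreover have "(\<Sum>c | c \<in> I' \<and> adj a c. y (I' - {c}) * y J) =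
        (\<Sum>c | c \<in> L \<and> adj a c. y (I' - {c}) * y J) + (\<Sum>c | c \<in> H \<and> adj a c. y (I' - {c}) * y J)"
      using fin a by (subst sum.union_disjoint[symmetric]) (auto simp: defs intro!: sum.cong)
    ultimately have "(\<Sum>c | c \<in> I' \<and> adj a c. y (I' - {c}) * y J) =
        (\<Sum>c | c \<in> U \<and> adj a c. T c) - (\<Sum>c | c \<in> J \<and> adj a c. E c)"
      by (simp add: cL cR cH sum_subtractf)
    moreover have "y I * y J = D a * (y I' * y J) - (\<Sum>c | c \<in> I' \<and> adj a c. y (I' - {c}) * y J)"
      unfolding I'_def using a less.prems by (subst rec[of I a]) (auto simp: algebra_simps sum_distrib_left)
    ultimately show ?thesis by (simp add: S)
  qed
qed

end

section \<open>Products over sets without arcs between them\<close>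

context vertex_recurrence begin

text \<open>As the intersection is empty, a link would be a single arc from \<open>I\<close> to
  \<open>J\<close>; hence only the empty linkage exists.\<close>

lemma mult_separated:
  assumes "finite I" "finite J" "I \<inter> J = {}" "\<And>u v. u \<in> I \<Longrightarrow> v \<in> J \<Longrightarrow> \<not> adj u v"
  shows "y I * y J = y (I \<union> J) * y {}"
proof -
  have "links adj I {} J = {}"
    using assms by (auto simp: links_def exit_paths_def elim!: exit_path.cases)
  then have "linkages adj I {} J = {{}}" by (auto simp: linkages_def)
  moreover have "I - J = I" "J - I = J" using assms by auto
  ultimately show ?thesis
    using assms by (subst mult_eq_sum_linkages) (simp_all add: support_def)
qed

lemma prod_separated:
  assumes "finite F" "\<And>I. I \<in> F \<Longrightarrow> finite I" "pairwise disjnt F" "y {} = 1"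
    and "\<And>I J u v. I \<in> F \<Longrightarrow> J \<in> F \<Longrightarrow> I \<noteq> J \<Longrightarrow> u \<in> I \<Longrightarrow> v \<in> J \<Longrightarrow> \<not> adj u v"
  shows "(\<Prod>I\<in>F. y I) = y (\<Union>F)"
  using assms
proof (induction F rule: finite_induct)
  case (insert I F)
  have "y I * y (\<Union>F) = y (I \<union> \<Union>F) * y {}"
  proof (rule mult_separated)
    show "I \<inter> \<Union>F = {}" using insert.hyps insert.prems(2) by (auto simp: pairwise_insert disjnt_def)
    fix u v assume "u \<in> I" "v \<in> \<Union>F"
    then show "\<not> adj u v" using insert.hyps insert.prems(4) by (metis UnionE insertCI)
  qed (use insert in auto)
  moreover have "(\<Prod>I\<in>F. y I) = y (\<Union>F)"
  proof (rule insert.IH)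
    show "\<not> adj u v" if "K \<in> F" "J \<in> F" "K \<noteq> J" "u \<in> K" "v \<in> J" for K J u v
      by (rule insert.prems(4)[of K J]) (use that in auto)
  qed (use insert.prems in \<open>auto simp: pairwise_insert\<close>)
  ultimately show ?case using insert by simp
qed simp

end

section \<open>Multiplication by a variable\<close>

locale variable_recurrence = vertex_recurrence adj D y
  for adj :: "'v \<Rightarrow> 'v \<Rightarrow> bool" and D :: "'v \<Rightarrow> 'r::comm_ring_1" and y +
  fixes x \<alpha> :: "'v \<Rightarrow> 'r"
  assumes adj_sym: "adj u v \<Longrightarrow> adj v u"
    and adj_irrefl: "\<not> adj u u"
    and finite_adj: "finite {w. adj u w}"
    and D_mult: "x a * D a = \<alpha> a + (\<Sum>w | adj a w. x w)"
begin

text \<open>The recurrence at \<open>c\<close> creates the negative terms. Each is paired with a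
  term \<open>x d * y (K - {c})\<close> from \<open>D_mult\<close>, in a difference that
  \<open>variable_mult_induct\<close> resolves.\<close>

lemma variable_mult:
  assumes "finite K" "c \<in> K"
  shows "x c * y K = \<alpha> c * y (K - {c}) + (\<Sum>w | adj c w \<and> w \<notin> K. x w * y (K - {c})) +
    (\<Sum>d | adj c d \<and> d \<in> K. x d * y (K - {c}) - x c * y (K - {c} - {d}))"
proof -
  have "x c * y K = x c * D c * y (K - {c}) - (\<Sum>d | d \<in> K - {c} \<and> adj c d. x c * y (K - {c} - {d}))"
    using assms by (subst rec[of K c]) (auto simp: algebra_simps sum_distrib_left)
  also have "{d. d \<in> K - {c} \<and> adj c d} = {d. adj c d \<and> d \<in> K}" using adj_irrefl by auto
  also have "x c * D c * y (K - {c}) = \<alpha> c * y (K - {c}) + (\<Sum>w | adj c w. x w * y (K - {c}))"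
    by (simp only: D_mult distrib_right sum_distrib_right)
  also have "(\<Sum>w | adj c w. x w * y (K - {c})) = (\<Sum>w | adj c w \<and> w \<notin> K. x w * y (K - {c})) +
      (\<Sum>w | adj c w \<and> w \<in> K. x w * y (K - {c}))"
    using finite_adj[of c] by (subst sum.union_disjoint[symmetric]) (auto intro!: sum.cong)
  finally show ?thesis by (simp add: sum_subtractf algebra_simps)
qed

text \<open>\<open>Q\<close> stands for membership in a cone closed under addition only, so the
  differences of \<open>variable_mult\<close> have to be rewritten as sums of terms with proper
  subsets of \<open>I\<close>.\<close>

lemma variable_mult_induct:
  assumes "finite I" "v \<in> I"
    and zero: "Q 0" and add: "\<And>p q. Q p \<Longrightarrow> Q q \<Longrightarrow> Q (p + q)"
    and \<alpha>: "\<And>u K. u \<in> I \<Longrightarrow> K \<subset> I \<Longrightarrow> Q (\<alpha> u * y K)"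
    and x: "\<And>u w K. u \<in> I \<Longrightarrow> adj u w \<Longrightarrow> K \<subset> I \<Longrightarrow> Q (x w * y K)"
  shows "Q (x v * y I)"
proof -
  have sum: "Q (\<Sum>i\<in>S. f i)" if "finite S" "\<And>i. i \<in> S \<Longrightarrow> Q (f i)" for S :: "'v set" and f
    using that by (induction S rule: finite_induct) (auto intro: zero add)
  \<comment> \<open>The neighbour \<open>u\<close> outside \<open>K\<close> supplies the summand
    that the subtraction removes. The remaining differences have the same form, with
    \<open>K - {c}\<close> for \<open>K\<close>, \<open>d\<close> for \<open>c\<close> and
    \<open>c\<close> for \<open>u\<close>.\<close>
  have Z: "Q (x c * y K - x u * y (K - {c}))"
    if "c \<in> K" "u \<notin> K" "adj c u" "K \<subseteq> I" for c u K
    using that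
  proof (induction "card K" arbitrary: K c u)
    case 0
    then show ?case using finite_subset[OF _ \<open>finite I\<close>] by auto
  next
    case (Suc n K c u)
    have K: "finite K" "K - {c} \<subset> I" using Suc.prems \<open>finite I\<close> by (auto intro: finite_subset)
    have "x c * y K = \<alpha> c * y (K - {c}) + (\<Sum>w | adj c w \<and> w \<notin> K. x w * y (K - {c})) +
      (\<Sum>d | adj c d \<and> d \<in> K. x d * y (K - {c}) - x c * y (K - {c} - {d}))"
      using K Suc.prems by (intro variable_mult)
    also have "{w. adj c w \<and> w \<notin> K} = insert u {w. adj c w \<and> w \<notin> K \<and> w \<noteq> u}"
      using Suc.prems by auto
    also have "(\<Sum>w\<in>\<dots>. x w * y (K - {c})) = x u * y (K - {c}) +
        (\<Sum>w | adj c w \<and> w \<notin> K \<and> w \<noteq> u. x w * y (K - {c}))"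
      using finite_adj[of c] by (subst sum.insert) auto
    finally have eq: "x c * y K - x u * y (K - {c}) = \<alpha> c * y (K - {c}) +
        (\<Sum>w | adj c w \<and> w \<notin> K \<and> w \<noteq> u. x w * y (K - {c})) +
        (\<Sum>d | adj c d \<and> d \<in> K. x d * y (K - {c}) - x c * y (K - {c} - {d}))"
      by simp
    have "Q (x d * y (K - {c}) - x c * y (K - {c} - {d}))" if "adj c d" "d \<in> K" for d
      using that Suc.prems Suc.hyps(2) K adj_irrefl adj_sym by (intro Suc.hyps(1)) auto
    moreover have "c \<in> I" using Suc.prems by auto
    ultimately show ?case unfolding eq
      using K finite_adj[of c] by (intro add sum \<alpha> x[of c]) auto
  qed
  have psub: "I - {v} \<subset> I" using \<open>v \<in> I\<close> by auto
  have "Q (x d * y (I - {v}) - x v * y (I - {v} - {d}))" if "adj v d" "d \<in> I" for d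
    using that adj_sym adj_irrefl by (intro Z) auto
  then show ?thesis unfolding variable_mult[OF assms(1,2)]
    using psub \<open>v \<in> I\<close> finite_adj[of v] by (intro add sum \<alpha> x[of v]) auto
qed

end

section \<open>The recurrence for the elements Y\<close>

text \<open>Shorten a walk from \<open>c\<close> to \<open>a\<close> inside \<open>r\<close> to a
  simple one and close it with the arc from \<open>a\<close> to \<open>c\<close>. This cycle has
  length at most two, so the shortened walk is the single arc \<open>(c, a)\<close>.\<close>

lemma bidirected_tree_back_arc:
  assumes tree: "bidirected_tree G" and r: "r \<subseteq> arcs_ends G" "(c, a) \<in> r\<^sup>*" and ac: "a \<rightarrow>\<^bsub>G\<^esub> c"
  shows "(c, a) \<in> r"
proof -
  interpret digraph G using tree by (simp add: bidirected_tree_def)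
  have "\<exists>p. awalk c p a \<and> (\<forall>e\<in>set p. arc_to_ends G e \<in> r)"
    using r(2)
  proof (induction rule: converse_rtrancl_induct)
    case base
    have "a \<in> verts G" using ac by (rule adj_in_verts)
    then show ?case by (intro exI[of _ "[]"]) (simp add: awalk_Nil_iff)
  next
    case (step u v)
    then obtain p where p: "awalk v p a" "\<forall>e\<in>set p. arc_to_ends G e \<in> r" by auto
    obtain e where "e \<in> arcs G" "arc_to_ends G e = (u, v)"
      using step.hyps(1) r(1) by (auto simp: arcs_ends_def)
    then show ?case using p step.hyps(1)
      by (intro exI[of _ "e # p"]) (auto simp: awalk_Cons_iff arc_to_ends_def)
  qed
  then obtain p0 where p0: "awalk c p0 a" "\<forall>e\<in>set p0. arc_to_ends G e \<in> r" by auto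
  define p where "p = awalk_to_apath p0"
  have p: "apath c p a" "\<forall>e\<in>set p. arc_to_ends G e \<in> r"
    using apath_awalk_to_apath[OF p0(1)] awalk_to_apath_subset[OF p0(1)] p0(2) by (auto simp: p_def)
  obtain e where e: "e \<in> arcs G" "tail G e = a" "head G e = c" using ac by (rule reachableE)
  have "cycle (e # p)"
    using p(1) e by (auto simp: cycle_def apath_def awalk_Cons_iff intro!: exI[of _ a])
  then have "length (e # p) < 3" using tree by (fastforce simp: bidirected_tree_def)
  moreover have "p \<noteq> []"
  proof
    assume "p = []"
    then have "c = a" using p(1) by (simp add: apath_def awalk_Nil_iff)
    then show False using ac adj_not_same by auto
  qed
  ultimately obtain e' where "p = [e']" by (cases p) auto
  then show ?thesis using p by (auto simp: apath_def awalk_Cons_iff awalk_Nil_iff arc_to_ends_def)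
qed

definition moves :: "'v set \<Rightarrow> ('v \<Rightarrow> 'v) \<Rightarrow> ('v \<times> 'v) set" where
  "moves I f = {(v, f v) | v. v \<in> I \<and> f v \<noteq> v}"

lemma moves_cong: "(\<And>v. v \<in> I \<Longrightarrow> f v = g v) \<Longrightarrow> moves I f = moves I g"
  by (auto simp: moves_def)

lemma acyclic_functions_iff:
  "f \<in> acyclic_functions G I \<longleftrightarrow>
    f \<in> (\<Pi>\<^sub>E v\<in>I. {w \<in> verts G. w = v \<or> v \<rightarrow>\<^bsub>G\<^esub> w}) \<and> acyclic (moves I f)"
  by (auto simp: acyclic_functions_def moves_def PiE_iff)

text \<open>Choosing \<open>f a\<close> freely and asking for acyclicity only away from
  \<open>a\<close> gives the product. The functions counted in excess have a cycle through
  \<open>a\<close>, in a tree a pair of opposite arcs between \<open>a\<close> and some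
  \<open>c\<close>. Its weight is 1, and the rest is an acyclic function on
  \<open>I - {a} - {c}\<close>.\<close>

lemma bidirected_tree_Y_rec:
  fixes A :: "'v \<Rightarrow> 'r::comm_ring_1"
  assumes tree: "bidirected_tree G" and I: "finite I" "a \<in> I"
  shows "Y G A I = (\<Sum>w | w \<in> verts G \<and> (w = a \<or> a \<rightarrow>\<^bsub>G\<^esub> w). X_tilde A a w * X_inv a) * Y G A (I - {a})
    - (\<Sum>c | c \<in> I - {a} \<and> a \<rightarrow>\<^bsub>G\<^esub> c. Y G A (I - {a} - {c}))"
proof -
  interpret digraph G using tree by (simp add: bidirected_tree_def)
  define wt where "wt v w = X_tilde A v w * X_inv v" for v w
  define N where "N v = {w \<in> verts G. w = v \<or> v \<rightarrow>\<^bsub>G\<^esub> w}" for v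
  define B where "B = {f \<in> Pi\<^sub>E I N. acyclic (moves (I - {a}) f)}"
  define C where "C c = {f \<in> B. f a = c \<and> f c = a}" for c
  have AF: "f \<in> acyclic_functions G J \<longleftrightarrow> f \<in> Pi\<^sub>E J N \<and> acyclic (moves J f)" for f J
    unfolding acyclic_functions_iff N_def by simp
  have Y: "Y G A J = (\<Sum>f\<in>acyclic_functions G J. \<Prod>v\<in>J. wt v (f v))" for J
    by (simp add: Y_def wt_def)
  have finB: "finite B"
    by (rule finite_subset[of _ "Pi\<^sub>E I N"]) (use I in \<open>auto simp: B_def N_def intro!: finite_PiE\<close>)
  have moves_insert: "moves I f = (if f a = a then moves (I - {a}) f else insert (a, f a) (moves (I - {a}) f))" for f
    using I by (auto simp: moves_def)
  have AFB: "acyclic_functions G I \<subseteq> B"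
    by (auto simp: AF B_def moves_insert split: if_splits)
  \<comment> \<open>Acyclicity away from \<open>a\<close> forces any cycle through \<open>a\<close>,
    so \<open>f a\<close> leads back to \<open>a\<close>; \<open>bidirected_tree_back_arc\<close>
    makes the return a single arc.\<close>
  have BC: "B - acyclic_functions G I = (\<Union>c\<in>{c \<in> I - {a}. a \<rightarrow>\<^bsub>G\<^esub> c}. C c)"
  proof (intro equalityI subsetI)
    fix f assume f: "f \<in> B - acyclic_functions G I"
    let ?r = "moves (I - {a}) f"
    have loc: "f \<in> Pi\<^sub>E I N" and ac: "acyclic ?r" and nac: "\<not> acyclic (moves I f)"
      using f by (auto simp: AF B_def)
    then have fa: "f a \<noteq> a" "(f a, a) \<in> ?r\<^sup>*" by (auto simp: moves_insert split: if_splits)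
    have "f a \<in> N a" using loc I by auto
    then have adj: "a \<rightarrow>\<^bsub>G\<^esub> f a" using fa by (auto simp: N_def)
    have "?r \<subseteq> arcs_ends G" using loc by (force simp: moves_def N_def)
    then have "(f a, a) \<in> ?r" using bidirected_tree_back_arc[OF tree] fa adj by auto
    then have "f a \<in> I - {a}" "f (f a) = a" by (auto simp: moves_def)
    then show "f \<in> (\<Union>c\<in>{c \<in> I - {a}. a \<rightarrow>\<^bsub>G\<^esub> c}. C c)" using f adj by (auto simp: C_def)
  next
    fix f assume "f \<in> (\<Union>c\<in>{c \<in> I - {a}. a \<rightarrow>\<^bsub>G\<^esub> c}. C c)"
    then obtain c where c: "c \<in> I - {a}" "f \<in> B" "f a = c" "f c = a" by (auto simp: C_def)
    then have "(c, a) \<in> moves (I - {a}) f" by (auto simp: moves_def)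
    then have "\<not> acyclic (moves I f)" using c by (auto simp: moves_insert)
    then show "f \<in> B - acyclic_functions G I" using c by (auto simp: AF)
  qed
  have sumB: "(\<Sum>f\<in>B. \<Prod>v\<in>I. wt v (f v)) = (\<Sum>w\<in>N a. wt a w) * Y G A (I - {a})"
  proof -
    have "(\<Sum>w\<in>N a. wt a w) * Y G A (I - {a}) =
        (\<Sum>(w, g)\<in>N a \<times> acyclic_functions G (I - {a}). wt a w * (\<Prod>v\<in>I - {a}. wt v (g v)))"
      by (simp add: Y sum_product sum.cartesian_product)
    also have "\<dots> = (\<Sum>f\<in>B. \<Prod>v\<in>I. wt v (f v))"
    \<comment> \<open>Members of \<open>Pi\<^sub>E\<close> are \<open>undefined\<close> off their
      domain, so resetting the value at \<open>a\<close> restricts \<open>f\<close> to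
      \<open>I - {a}\<close>.\<close>
    proof (rule sum.reindex_bij_witness[where j = "\<lambda>(w, g). g(a := w)" and i = "\<lambda>f. (f a, f(a := undefined))"],
        goal_cases)
      case (1 p)
      then show ?case by (auto simp: AF PiE_iff extensional_def fun_eq_iff)
    next
      case (2 p)
      then obtain w g where p: "p = (w, g)" "w \<in> N a" "g \<in> Pi\<^sub>E (I - {a}) N" "acyclic (moves (I - {a}) g)"
        by (auto simp: AF)
      moreover have "moves (I - {a}) (g(a := w)) = moves (I - {a}) g" by (rule moves_cong) auto
      ultimately show ?case using I by (auto simp: B_def PiE_iff extensional_def)
    next
      case (3 f)
      then show ?case by auto
    next
      case (4 f)
      moreover have "moves (I - {a}) (f(a := undefined)) = moves (I - {a}) f" by (rule moves_cong) auto
      ultimately show ?case using I by (auto simp: B_def AF PiE_iff extensional_def)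
    next
      case (5 p)
      have "(\<Prod>v\<in>I. wt v (((snd p)(a := fst p)) v)) = wt a (fst p) * (\<Prod>v\<in>I - {a}. wt v (snd p v))"
        using I by (subst prod.remove[of I a]) (auto intro!: prod.cong)
      then show ?case by (simp add: split_def)
    qed
    finally show ?thesis by simp
  qed
  have sumC: "(\<Sum>f\<in>C c. \<Prod>v\<in>I. wt v (f v)) = Y G A (I - {a} - {c})"
    if c: "c \<in> I - {a}" "a \<rightarrow>\<^bsub>G\<^esub> c" for c
  proof -
    have ca: "c \<rightarrow>\<^bsub>G\<^esub> a" using c(2) tree arcs_ends_symmetric by (auto simp: bidirected_tree_def)
    have V: "a \<in> verts G" "c \<in> verts G" using c(2) adj_in_verts by auto
    have ac: "a \<noteq> c" "c \<noteq> a" using c by auto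
    have one: "wt a c * wt c a = 1"
    proof -
      have "wt a c * wt c a = (X a * X_inv a) * (X c * X_inv c)"
        using ac by (simp add: wt_def X_tilde_def mult_ac)
      then show ?thesis by (simp add: X_times_X_inv)
    qed
    \<comment> \<open>No move starts at \<open>a\<close> here, so the extra move from
      \<open>c\<close> to \<open>a\<close> closes no cycle.\<close>
    have mv: "acyclic (moves (I - {a}) f) \<longleftrightarrow> acyclic (moves (I - {a} - {c}) f)" if "f c = a" for f
    proof -
      have "moves (I - {a}) f = insert (c, a) (moves (I - {a} - {c}) f)"
        using that c by (auto simp: moves_def)
      moreover have "(a, c) \<notin> (moves (I - {a} - {c}) f)\<^sup>*"
      proof
        assume "(a, c) \<in> (moves (I - {a} - {c}) f)\<^sup>*"
        then show False using c by (cases rule: converse_rtranclE) (auto simp: moves_def)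
      qed
      ultimately show ?thesis by simp
    qed
    have "(\<Sum>f\<in>C c. \<Prod>v\<in>I. wt v (f v)) =
        (\<Sum>g\<in>acyclic_functions G (I - {a} - {c}). \<Prod>v\<in>I - {a} - {c}. wt v (g v))"
    proof (rule sum.reindex_bij_witness[where j = "\<lambda>f. f(a := undefined, c := undefined)"
          and i = "\<lambda>g. g(a := c, c := a)"], goal_cases)
      case (1 f)
      then show ?case by (auto simp: C_def)
    next
      case (2 f)
      moreover have "moves (I - {a} - {c}) (f(a := undefined, c := undefined)) = moves (I - {a} - {c}) f"
        by (rule moves_cong) auto
      ultimately show ?case using I c mv[of f] by (auto simp: C_def B_def AF PiE_iff extensional_def)
    next
      case (3 g)
      then show ?case using c by (auto simp: AF PiE_iff extensional_def fun_eq_iff)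
    next
      case (4 g)
      have "moves (I - {a} - {c}) (g(a := c, c := a)) = moves (I - {a} - {c}) g"
        by (rule moves_cong) auto
      moreover have "c \<in> N a" "a \<in> N c" using ca c V by (auto simp: N_def)
      ultimately show ?case using 4 I c mv[of "g(a := c, c := a)"]
        by (auto simp: C_def B_def AF PiE_iff extensional_def)
    next
      case (5 f)
      then have "f a = c" "f c = a" by (auto simp: C_def)
      have "(\<Prod>v\<in>I. wt v (f v)) = wt a c * (wt c a * (\<Prod>v\<in>I - {a} - {c}. wt v (f v)))"
        using I c \<open>f a = c\<close> \<open>f c = a\<close> by (simp add: prod.remove[of I a] prod.remove[of "I - {a}" c])
      also have "\<dots> = (\<Prod>v\<in>I - {a} - {c}. wt v (f v))"
        using one by (simp flip: mult.assoc)
      finally show ?case by (auto intro!: prod.cong)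
    qed
    then show ?thesis by (simp add: Y)
  qed
  have "(\<Sum>f\<in>B. \<Prod>v\<in>I. wt v (f v)) = (\<Sum>f\<in>B - acyclic_functions G I. \<Prod>v\<in>I. wt v (f v)) + Y G A I"
    unfolding Y by (rule sum.subset_diff[OF AFB finB])
  also have "(\<Sum>f\<in>B - acyclic_functions G I. \<Prod>v\<in>I. wt v (f v)) =
      (\<Sum>c\<in>{c \<in> I - {a}. a \<rightarrow>\<^bsub>G\<^esub> c}. \<Sum>f\<in>C c. \<Prod>v\<in>I. wt v (f v))"
    unfolding BC using I finB by (intro sum.UNION_disjoint) (auto simp: C_def)
  also have "\<dots> = (\<Sum>c | c \<in> I - {a} \<and> a \<rightarrow>\<^bsub>G\<^esub> c. Y G A (I - {a} - {c}))"
    by (intro sum.cong sumC) auto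
  finally show ?thesis unfolding sumB by (simp add: wt_def N_def algebra_simps)
qed

section \<open>Strong components of a chain of sets\<close>

text \<open>Symmetry lets every arc be traversed back, so maximality of a component becomes closure
  under neighbours inside \<open>U\<close>.\<close>

lemma strong_components_iff:
  assumes "wf_digraph G" "symmetric G"
  shows "K \<in> strong_components G U \<longleftrightarrow>
    K \<noteq> {} \<and> K \<subseteq> U \<and> (\<forall>u\<in>K. \<forall>v\<in>K. u \<rightarrow>\<^sup>*\<^bsub>G \<restriction> K\<^esub> v) \<and> (\<forall>u\<in>K. \<forall>v\<in>U. u \<rightarrow>\<^bsub>G\<^esub> v \<longrightarrow> v \<in> K)"
    (is "_ \<longleftrightarrow> ?r")
proof -
  interpret wf_digraph G by fact
  interpret H: wf_digraph "G \<restriction> U" by (rule wellformed_induce_subgraph)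
  have adj: "u \<rightarrow>\<^bsub>G \<restriction> U\<^esub> v \<longleftrightarrow> u \<rightarrow>\<^bsub>G\<^esub> v \<and> u \<in> U \<and> v \<in> U" for u v
    by (auto simp: arcs_ends_def arc_to_ends_def)
  have "K \<in> H.sccs_verts \<longleftrightarrow> ?r"
  proof
    assume K: "K \<in> H.sccs_verts"
    then interpret K: max_reachable_set "G \<restriction> U" K by unfold_locales
    have sub: "K \<subseteq> U" using H.sccs_verts_subsets[OF K] by simp
    then have "(G \<restriction> U) \<restriction> K = G \<restriction> K" by (auto simp: induce_subgraph_def)
    then have "u \<rightarrow>\<^sup>*\<^bsub>G \<restriction> K\<^esub> v" if "u \<in> K" "v \<in> K" for u v
      using K.reachable_induced K.reach_in that by simp
    moreover have "v \<in> K" if "u \<in> K" "v \<in> U" "u \<rightarrow>\<^bsub>G\<^esub> v" for u v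
    proof (rule ccontr)
      assume "v \<notin> K"
      moreover have "u \<rightarrow>\<^sup>*\<^bsub>G \<restriction> U\<^esub> v" "v \<rightarrow>\<^sup>*\<^bsub>G \<restriction> U\<^esub> u"
        using that sub arcs_ends_symmetric[OF assms(2)] by (auto intro!: H.reachable_adjI simp: adj)
      ultimately show False using K.not_reach_out that by blast
    qed
    ultimately show ?r using sub K.not_empty by auto
  next
    assume r: ?r
    have stay: "v \<in> K" if "u \<rightarrow>\<^sup>*\<^bsub>G \<restriction> U\<^esub> v" "u \<in> K" for u v
      using that by (induction rule: H.reachable_induct) (use r in \<open>auto simp: adj\<close>)
    then show "K \<in> H.sccs_verts"
      using r unfolding H.in_sccs_verts_conv_reachable by (meson reachable_induce_ss)
  qed
  then show ?thesis by (simp add: strong_components_def H.sccs_verts_conv)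
qed

context
  fixes G :: "('v, 'e) pre_digraph"
  assumes wf: "wf_digraph G" and sym: "symmetric G"
begin

lemma Union_strong_components: "\<Union>(strong_components G U) = U"
proof -
  interpret wf_digraph G by (rule wf)
  interpret H: wf_digraph "G \<restriction> U" by (rule wellformed_induce_subgraph)
  have "u \<in> H.scc_of u" if "u \<in> U" for u using H.in_scc_of_self that by simp
  then have "U \<subseteq> \<Union>H.sccs_verts" unfolding H.sccs_verts_conv_scc_of by auto
  moreover have "\<Union>H.sccs_verts \<subseteq> U" using H.sccs_verts_subsets by auto
  ultimately show ?thesis by (auto simp: strong_components_def H.sccs_verts_conv)
qed

text \<open>A walk inside \<open>K\<close> from a common vertex stays in \<open>J\<close>, and
  \<open>L\<close> is closed under neighbours in \<open>J\<close>.\<close>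

lemma strong_components_mono:
  assumes "K \<in> strong_components G I" "L \<in> strong_components G J" "I \<subseteq> J" "K \<inter> L \<noteq> {}"
  shows "K \<subseteq> L"
proof
  interpret wf_digraph G by (rule wf)
  interpret H: wf_digraph "G \<restriction> K" by (rule wellformed_induce_subgraph)
  note iff = strong_components_iff[OF wf sym]
  fix w assume "w \<in> K"
  obtain z where z: "z \<in> K" "z \<in> L" using assms by auto
  then have "z \<rightarrow>\<^sup>*\<^bsub>G \<restriction> K\<^esub> w" using assms(1) \<open>w \<in> K\<close> by (simp add: iff)
  then show "w \<in> L"
  proof (induction rule: H.reachable_induct)
    case (step x y)
    then have "x \<rightarrow>\<^bsub>G\<^esub> y" "y \<in> K" by (auto simp: arcs_ends_def arc_to_ends_def)
    then show ?case using step.IH assms by (auto simp: iff)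
  qed (rule z)
qed

lemma pairwise_disjnt_strong_components: "pairwise disjnt (strong_components G U)"
proof (rule pairwiseI)
  fix K L assume "K \<in> strong_components G U" "L \<in> strong_components G U" "K \<noteq> L"
  then show "disjnt K L"
    using strong_components_mono[of K U L U] strong_components_mono[of L U K U] by (auto simp: disjnt_def)
qed

text \<open>Suppose an arc joins two disjoint members, components of comparable sets
  \<open>I\<close> and \<open>J\<close>. Both ends lie in the larger set, whose component would
  absorb the other end.\<close>

lemma strong_components_chain:
  assumes chain: "\<And>I J. I \<in> F \<Longrightarrow> J \<in> F \<Longrightarrow> I \<subseteq> J \<or> J \<subseteq> I"
    and R: "R \<subseteq> (\<Union>I\<in>F. strong_components G I)" "pairwise disjnt R"
  shows "R \<subseteq> strong_components G (\<Union>R)"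
proof
  note iff = strong_components_iff[OF wf sym]
  fix K assume K: "K \<in> R"
  then obtain I where I: "I \<in> F" "K \<in> strong_components G I" using R by auto
  have "v \<in> K" if uv: "u \<in> K" "v \<in> \<Union>R" "u \<rightarrow>\<^bsub>G\<^esub> v" for u v
  proof (rule ccontr)
    assume "v \<notin> K"
    obtain L where L: "L \<in> R" "v \<in> L" using uv by auto
    then have "disjnt K L" using K R \<open>v \<notin> K\<close> by (auto simp: pairwise_def)
    obtain J where J: "J \<in> F" "L \<in> strong_components G J" using L R by auto
    have "v \<rightarrow>\<^bsub>G\<^esub> u" using arcs_ends_symmetric[OF sym] uv by auto
    from chain[OF I(1) J(1)] show False
    proof
      assume "I \<subseteq> J"
      then have "u \<in> L" using I(2) J(2) L uv \<open>v \<rightarrow>\<^bsub>G\<^esub> u\<close> by (auto simp: iff)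
      then show False using \<open>disjnt K L\<close> uv by (auto simp: disjnt_def)
    next
      assume "J \<subseteq> I"
      then have "v \<in> K" using I(2) J(2) L uv by (auto simp: iff)
      then show False using \<open>v \<notin> K\<close> by simp
    qed
  qed
  then have "\<forall>u\<in>K. \<forall>v\<in>\<Union>R. u \<rightarrow>\<^bsub>G\<^esub> v \<longrightarrow> v \<in> K" by blast
  moreover have "K \<subseteq> \<Union>R" using K by auto
  ultimately show "K \<in> strong_components G (\<Union>R)" using I(2) unfolding iff by blast
qed

lemma nested_collection_chain:
  assumes chain: "\<And>I J. I \<in> F \<Longrightarrow> J \<in> F \<Longrightarrow> I \<subseteq> J \<or> J \<subseteq> I" and F: "\<And>I. I \<in> F \<Longrightarrow> I \<subseteq> verts G"
  shows "nested_collection G (\<Union>I\<in>F. strong_components G I)"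
  unfolding nested_collection_def
proof (intro conjI ballI allI impI)
  note iff = strong_components_iff[OF wf sym]
  fix K assume "K \<in> (\<Union>I\<in>F. strong_components G I)"
  then obtain I where I: "I \<in> F" "K \<in> strong_components G I" by auto
  then show "K \<noteq> {}" "K \<subseteq> verts G" using F by (auto simp: iff)
  fix L assume "L \<in> (\<Union>I\<in>F. strong_components G I)"
  then obtain J where J: "J \<in> F" "L \<in> strong_components G J" by auto
  from chain[OF I(1) J(1)] show "K \<subseteq> L \<or> L \<subseteq> K \<or> K \<inter> L = {}"
    using strong_components_mono[of K I L J] strong_components_mono[of L J K I] I J by auto
qed (rule strong_components_chain[OF chain])

end

section \<open>Nonnegative combinations of cluster monomials\<close>

definition var_monomial :: "('v \<Rightarrow> 'r::comm_ring_1) \<Rightarrow> ('v \<Rightarrow>\<^sub>0 nat) \<Rightarrow> 'r" where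
  "var_monomial A m = (\<Prod>v\<in>Poly_Mapping.keys m. A v ^ Poly_Mapping.lookup m v)"

lemma var_monomial_superset:
  assumes "finite K" "Poly_Mapping.keys m \<subseteq> K"
  shows "var_monomial A m = (\<Prod>v\<in>K. A v ^ Poly_Mapping.lookup m v)"
  unfolding var_monomial_def using assms
  by (intro prod.mono_neutral_left) (auto simp: in_keys_iff)

lemma var_monomial_add: "var_monomial A (m + n) = var_monomial A m * var_monomial A n"
proof -
  let ?K = "Poly_Mapping.keys m \<union> Poly_Mapping.keys n"
  have "Poly_Mapping.keys (m + n) \<subseteq> ?K" by (rule Poly_Mapping.keys_add)
  then show ?thesis
    by (simp add: var_monomial_superset[of ?K] lookup_add power_add prod.distrib)
qed

lemma var_monomial_single: "var_monomial A (Poly_Mapping.single v 1) = A v"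
  by (simp add: var_monomial_def)

lemma eval_int_poly_superset:
  assumes "finite K" "Poly_Mapping.keys P \<subseteq> K"
  shows "eval_int_poly A P = (\<Sum>m\<in>K. of_int (Poly_Mapping.lookup P m) * var_monomial A m)"
  unfolding eval_int_poly_def var_monomial_def[symmetric] using assms
  by (intro sum.mono_neutral_left) (auto simp: in_keys_iff)

lemma eval_int_poly_add: "eval_int_poly A (P + Q) = eval_int_poly A P + eval_int_poly A Q"
proof -
  let ?K = "Poly_Mapping.keys P \<union> Poly_Mapping.keys Q"
  have "Poly_Mapping.keys (P + Q) \<subseteq> ?K" by (rule Poly_Mapping.keys_add)
  then show ?thesis
    by (simp add: eval_int_poly_superset[of ?K] lookup_add sum.distrib distrib_right)
qed

lemma eval_int_poly_single: "eval_int_poly A (Poly_Mapping.single m c) = of_int c * var_monomial A m"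
  by (simp add: eval_int_poly_superset[of "{m}"])

lemma eval_int_poly_sum: "eval_int_poly A (\<Sum>i\<in>S. P i) = (\<Sum>i\<in>S. eval_int_poly A (P i))"
proof (induction S rule: infinite_finite_induct)
  case (insert i S)
  then show ?case by (simp add: eval_int_poly_add)
qed (simp_all add: eval_int_poly_def)

lemma nonneg_coeff_0: "nonneg_coeff V A 0"
  unfolding nonneg_coeff_def by (rule exI[of _ 0]) (simp add: int_poly_in_def eval_int_poly_def)

lemma nonneg_coeff_1: "nonneg_coeff V A 1"
proof -
  have "eval_int_poly A 1 = 1"
    using eval_int_poly_single[of A 0 1] by (simp add: var_monomial_def)
  then show ?thesis unfolding nonneg_coeff_def
    by (intro exI[of _ 1]) (auto simp: int_poly_in_def lookup_one when_def)
qed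

lemma nonneg_coeff_add:
  assumes "nonneg_coeff V A r" "nonneg_coeff V A s"
  shows "nonneg_coeff V A (r + s)"
proof -
  from assms obtain P Q where
    "int_poly_in V P" "\<forall>m. 0 \<le> Poly_Mapping.lookup P m" "r = eval_int_poly A P"
    "int_poly_in V Q" "\<forall>m. 0 \<le> Poly_Mapping.lookup Q m" "s = eval_int_poly A Q"
    unfolding nonneg_coeff_def by auto
  moreover from this have "int_poly_in V (P + Q)"
    using Poly_Mapping.keys_add[of P Q] unfolding int_poly_in_def by blast
  ultimately show ?thesis unfolding nonneg_coeff_def
    by (intro exI[of _ "P + Q"]) (auto simp: eval_int_poly_add lookup_add)
qed

lemma nonneg_coeff_mult_var:
  assumes "nonneg_coeff V A r" "v \<in> V"
  shows "nonneg_coeff V A (A v * r)"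
proof -
  from assms obtain P where P:
    "int_poly_in V P" "\<And>m. 0 \<le> Poly_Mapping.lookup P m" "r = eval_int_poly A P"
    unfolding nonneg_coeff_def by auto
  let ?m = "Poly_Mapping.single v (1::nat)"
  \<comment> \<open>\<open>Q\<close> is \<open>P\<close> times the variable \<open>v\<close>: every
    exponent is shifted by \<open>?m\<close>.\<close>
  define Q where "Q = (\<Sum>m\<in>Poly_Mapping.keys P. Poly_Mapping.single (?m + m) (Poly_Mapping.lookup P m))"
  have "Poly_Mapping.keys Q \<subseteq> (+) ?m ` Poly_Mapping.keys P"
    unfolding Q_def by (rule order_trans[OF keys_sum]) (auto split: if_splits)
  moreover have "Poly_Mapping.keys (?m + m) \<subseteq> V" if "m \<in> Poly_Mapping.keys P" for m
    using Poly_Mapping.keys_add[of ?m m] P(1) that assms(2) by (auto simp: int_poly_in_def split: if_splits)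
  ultimately have "int_poly_in V Q" by (fastforce simp: int_poly_in_def)
  moreover have "0 \<le> Poly_Mapping.lookup Q m" for m
    using P(2) by (auto simp: Q_def lookup_sum lookup_single when_def intro!: sum_nonneg)
  moreover have "A v * r = eval_int_poly A Q"
    using eval_int_poly_superset[of "Poly_Mapping.keys P" P A]
    by (simp add: Q_def P(3) eval_int_poly_sum eval_int_poly_single var_monomial_add
        var_monomial_single sum_distrib_left mult_ac del: One_nat_def)
  ultimately show ?thesis unfolding nonneg_coeff_def by auto
qed

lemma lconst_0: "lconst 0 = 0"
  by (simp add: lconst_def)

lemma lconst_1: "lconst 1 = 1"
  by (simp add: lconst_def)

lemma lconst_add: "lconst (r + s) = lconst r + lconst s"
  by (simp add: lconst_def single_add)

lemma lconst_mult: "lconst (r * s) = lconst r * lconst s"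
  by (simp add: lconst_def mult_single)

text \<open>The conclusion of the theorem, turned into a set with closure properties. Coefficients
  are indexed by ring elements, so a monomial occurring in both summands of a sum receives the sum
  of its coefficients.\<close>

definition cluster_cone :: "('v, 'e) pre_digraph \<Rightarrow> ('v \<Rightarrow> 'r) \<Rightarrow> ('v, 'r::comm_ring_1) laurent set" where
  "cluster_cone G A = {z. \<exists>C c. finite C \<and> C \<subseteq> cluster_monomials G A \<and>
     (\<forall>m\<in>C. nonneg_coeff (verts G) A (c m)) \<and> z = (\<Sum>m\<in>C. lconst (c m) * m)}"

lemma cluster_cone_base: "m \<in> cluster_monomials G A \<Longrightarrow> m \<in> cluster_cone G A"
  unfolding cluster_cone_def
  by (intro CollectI exI[of _ "{m}"] exI[of _ "\<lambda>_. 1"]) (simp add: nonneg_coeff_1 lconst_1)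

lemma cluster_cone_0: "0 \<in> cluster_cone G A"
  unfolding cluster_cone_def by (intro CollectI exI[of _ "{}"]) simp

lemma cluster_cone_add:
  assumes "p \<in> cluster_cone G A" "q \<in> cluster_cone G A"
  shows "p + q \<in> cluster_cone G A"
proof -
  let ?nn = "nonneg_coeff (verts G) A"
  from assms obtain C c D d where
    C: "finite C" "C \<subseteq> cluster_monomials G A" "\<forall>m\<in>C. ?nn (c m)" "p = (\<Sum>m\<in>C. lconst (c m) * m)" and
    D: "finite D" "D \<subseteq> cluster_monomials G A" "\<forall>m\<in>D. ?nn (d m)" "q = (\<Sum>m\<in>D. lconst (d m) * m)"
    unfolding cluster_cone_def by blast
  define e where "e m = (if m \<in> C then c m else 0) + (if m \<in> D then d m else 0)" for m
  have "p = (\<Sum>m\<in>C \<union> D. lconst (if m \<in> C then c m else 0) * m)"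
    unfolding C(4) using C(1) D(1) by (intro sum.mono_neutral_cong_left) (auto simp: lconst_0)
  moreover have "q = (\<Sum>m\<in>C \<union> D. lconst (if m \<in> D then d m else 0) * m)"
    unfolding D(4) using C(1) D(1) by (intro sum.mono_neutral_cong_left) (auto simp: lconst_0)
  ultimately have "p + q = (\<Sum>m\<in>C \<union> D. lconst (e m) * m)"
    by (simp add: e_def lconst_add distrib_right sum.distrib)
  moreover have "\<forall>m\<in>C \<union> D. ?nn (e m)"
    using C(3) D(3) by (auto simp: e_def nonneg_coeff_0 intro!: nonneg_coeff_add)
  ultimately show ?thesis unfolding cluster_cone_def using C(1,2) D(1,2) by blast
qed

lemma cluster_cone_sum:
  "(\<And>i. i \<in> S \<Longrightarrow> p i \<in> cluster_cone G A) \<Longrightarrow> (\<Sum>i\<in>S. p i) \<in> cluster_cone G A"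
  by (induction S rule: infinite_finite_induct) (auto intro: cluster_cone_0 cluster_cone_add)

lemma cluster_cone_mult_var:
  assumes "p \<in> cluster_cone G A" "v \<in> verts G"
  shows "lconst (A v) * p \<in> cluster_cone G A"
proof -
  from assms obtain C c where
    C: "finite C" "C \<subseteq> cluster_monomials G A" "\<forall>m\<in>C. nonneg_coeff (verts G) A (c m)"
      "p = (\<Sum>m\<in>C. lconst (c m) * m)"
    unfolding cluster_cone_def by blast
  have "lconst (A v) * p = (\<Sum>m\<in>C. lconst (A v * c m) * m)"
    by (simp add: C(4) lconst_mult sum_distrib_left mult_ac)
  then show ?thesis unfolding cluster_cone_def
    using C assms(2)
    by (intro CollectI exI[of _ C] exI[of _ "\<lambda>m. A v * c m"]) (auto intro: nonneg_coeff_mult_var)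
qed

lemma monomial_add_X: "monomial G A (add_mset v U) S = X v * monomial G A U S"
  by (simp add: monomial_def mult_ac)

lemma monomial_add_Y: "monomial G A U (add_mset I S) = Y G A I * monomial G A U S"
  by (simp add: monomial_def mult_ac)

section \<open>The termination measure\<close>

text \<open>For sizes \<open>k \<le> n\<close> the subtraction is exact and the function is strictly
  increasing and strictly concave. Monotonicity covers passing to a proper subset, concavity
  replacing two sets by their union and intersection.\<close>

definition bulk :: "nat \<Rightarrow> nat \<Rightarrow> nat" where
  "bulk n k = k * (2 * n + 1 - k)"

lemma int_bulk: "k \<le> n \<Longrightarrow> int (bulk n k) = int k * (2 * int n + 1 - int k)"
  unfolding bulk_def of_nat_mult by (simp add: of_nat_diff)

lemma bulk_less: "k < l \<Longrightarrow> l \<le> n \<Longrightarrow> bulk n k < bulk n l"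
proof -
  assume kl: "k < l" "l \<le> n"
  have "int (bulk n l) - int (bulk n k) = (int l - int k) * (2 * int n + 1 - int k - int l)"
    using kl by (simp add: int_bulk algebra_simps)
  also have "\<dots> > 0" using kl by (intro mult_pos_pos) auto
  finally show ?thesis by simp
qed

lemma bulk_mono: "k \<le> l \<Longrightarrow> l \<le> n \<Longrightarrow> bulk n k \<le> bulk n l"
  using bulk_less[of k l n] by (cases "k = l") auto

text \<open>The total size is preserved, so the linear parts cancel and the squares leave
  \<open>2 * (u - i) * (u - j)\<close>.\<close>

lemma bulk_concave:
  assumes "h < i" "i < u" "j < u" "u \<le> n" "u + h = i + j"
  shows "bulk n u + bulk n h < bulk n i + bulk n j"
proof -
  have h: "int h = int i + int j - int u" using assms(5) by simp
  have "int (bulk n i) + int (bulk n j) - (int (bulk n u) + int (bulk n h)) =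
      2 * (int u - int i) * (int u - int j)"
    using assms by (simp add: int_bulk h algebra_simps)
  also have "\<dots> > 0" using assms by (intro mult_pos_pos) auto
  finally show ?thesis by simp
qed

section \<open>Rewriting monomials into cluster monomials\<close>

locale bidirected_tree_algebra =
  fixes G :: "('v, 'e) pre_digraph" and A :: "'v \<Rightarrow> 'r::comm_ring_1"
  assumes tree: "bidirected_tree G"
begin

sublocale digraph G
  using tree by (simp add: bidirected_tree_def)

lemma symmetric_G: "symmetric G"
  using tree by (simp add: bidirected_tree_def)

text \<open>The parameter \<open>D a\<close> is \<open>Y G A {a}\<close> written out. Off the graph
  this sum is empty and there are no neighbours, so \<open>\<alpha>\<close> is 0 there to keep
  \<open>D_mult\<close> true for every element of the type.\<close>

sublocale variable_recurrence "dominates G"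
  "\<lambda>a. \<Sum>w | w \<in> verts G \<and> (w = a \<or> a \<rightarrow>\<^bsub>G\<^esub> w). X_tilde A a w * X_inv a" "Y G A" X
  "\<lambda>a. if a \<in> verts G then lconst (A a) else 0"
proof
  fix a :: 'v
  have N: "{w. w \<in> verts G \<and> (w = a \<or> a \<rightarrow>\<^bsub>G\<^esub> w)} =
      (if a \<in> verts G then insert a {w. a \<rightarrow>\<^bsub>G\<^esub> w} else {})"
    using adj_in_verts by auto
  show fin: "finite {w. a \<rightarrow>\<^bsub>G\<^esub> w}"
    by (rule finite_subset[OF _ finite_verts]) (auto dest: adj_in_verts)
  have na: "\<not> a \<rightarrow>\<^bsub>G\<^esub> a" using adj_not_same by auto
  then show "(a, a) \<notin> arcs_ends G" .
  have XX: "X a * (z * X_inv a) = z" for z :: "('v, 'r) laurent"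
    using X_times_X_inv[of a] by (metis mult.commute mult.left_commute mult_1)
  have "(\<Sum>w | a \<rightarrow>\<^bsub>G\<^esub> w. X_tilde A a w) = (\<Sum>w | a \<rightarrow>\<^bsub>G\<^esub> w. X w)"
    using na by (intro sum.cong) (auto simp: X_tilde_def)
  moreover have "{w. a \<rightarrow>\<^bsub>G\<^esub> w} = {}" if "a \<notin> verts G" using that adj_in_verts by auto
  ultimately show "X a * (\<Sum>w | w \<in> verts G \<and> (w = a \<or> a \<rightarrow>\<^bsub>G\<^esub> w). X_tilde A a w * X_inv a) =
      (if a \<in> verts G then lconst (A a) else 0) + (\<Sum>w | a \<rightarrow>\<^bsub>G\<^esub> w. X w)"
    using fin na by (simp add: N sum_distrib_left XX X_tilde_def)
next
  fix u v assume "u \<rightarrow>\<^bsub>G\<^esub> v"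
  then show "v \<rightarrow>\<^bsub>G\<^esub> u" using arcs_ends_symmetric[OF symmetric_G] by auto
qed (rule bidirected_tree_Y_rec[OF tree])

text \<open>Distinct components of \<open>I\<close> are disjoint and joined by no arc, so
  \<open>prod_separated\<close> applies.\<close>

lemma Y_strong_components:
  assumes "finite I"
  shows "(\<Prod>K\<in>strong_components G I. Y G A K) = Y G A I"
proof -
  note iff = strong_components_iff[OF wf_digraph symmetric_G]
  note disj = pairwise_disjnt_strong_components[OF wf_digraph symmetric_G, of I]
  have sub: "K \<subseteq> I" if "K \<in> strong_components G I" for K using that by (simp add: iff)
  have "(\<Prod>K\<in>strong_components G I. Y G A K) = Y G A (\<Union>(strong_components G I))"
  proof (rule prod_separated[OF _ _ disj Y_empty])
    show "finite (strong_components G I)"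
      by (rule finite_subset[of _ "Pow I"]) (use sub assms in auto)
    show "finite K" if "K \<in> strong_components G I" for K
      using sub[OF that] assms by (rule finite_subset)
    show "(u, v) \<notin> arcs_ends G"
      if KL: "K \<in> strong_components G I" "L \<in> strong_components G I" "K \<noteq> L" "u \<in> K" "v \<in> L" for K L u v
    proof
      assume "u \<rightarrow>\<^bsub>G\<^esub> v"
      then have "v \<in> K" using KL sub[OF KL(2)] by (auto simp: iff)
      moreover have "disjnt K L" using disj KL by (auto simp: pairwise_def)
      ultimately show False using KL by (auto simp: disjnt_def)
    qed
  qed
  then show ?thesis by (simp add: Union_strong_components[OF wf_digraph symmetric_G])
qed

lemma cluster_monomial_chain:
  assumes chain: "\<And>I J. I \<in># S \<Longrightarrow> J \<in># S \<Longrightarrow> I \<subseteq> J \<or> J \<subseteq> I"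
    and S: "\<And>I. I \<in># S \<Longrightarrow> I \<subseteq> verts G" and U: "set_mset U \<subseteq> verts G"
    and disj: "\<And>I. I \<in># S \<Longrightarrow> I \<inter> set_mset U = {}"
  shows "monomial G A U S \<in> cluster_monomials G A"
proof -
  note iff = strong_components_iff[OF wf_digraph symmetric_G]
  \<comment> \<open>The sum of multisets counts a component once for each occurrence in
    \<open>S\<close> of a set to which it belongs as a component, so the product of the
    \<open>Y\<close> is preserved with multiplicity.\<close>
  define N where "N = (\<Sum>I\<in>#S. mset_set (strong_components G I))"
  have fin: "finite I" "finite (strong_components G I)" if "I \<in># S" for I
  proof -
    show "finite I" using S[OF that] finite_verts by (rule finite_subset)
    then show "finite (strong_components G I)"
      by (rule_tac finite_subset[of _ "Pow I"]) (auto simp: iff)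
  qed
  have set_N: "set_mset N = (\<Union>I\<in>set_mset S. strong_components G I)"
    using fin by (auto simp: N_def)
  have "(\<Prod>K\<in>#N. Y G A K) = (\<Prod>I\<in>#S. Y G A I)"
    unfolding N_def using fin(1)
  proof (induction S)
    case (add I S)
    then show ?case
      by (simp add: Y_strong_components flip: prod_unfold_prod_mset)
  qed simp
  then have "monomial G A U S = monomial G A U N" by (simp add: monomial_def)
  moreover have "nested_multicollection G N"
    unfolding nested_multicollection_def set_N
    using chain S by (intro nested_collection_chain[OF wf_digraph symmetric_G]) auto
  moreover have "K \<inter> set_mset U = {}" if "K \<in># N" for K
    using that disj unfolding set_N by (fastforce simp: iff)
  ultimately show ?thesis using U unfolding cluster_monomials_def by blast
qed

lemma monomial_in_cluster_cone:
  assumes "set_mset U \<subseteq> verts G" "\<And>I. I \<in># S \<Longrightarrow> I \<subseteq> verts G"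
  shows "monomial G A U S \<in> cluster_cone G A"
  using assms
proof (induction "\<Sum>I\<in>#S. bulk (card (verts G)) (card I)" arbitrary: U S rule: less_induct)
  case (less S U)
  define n where "n = card (verts G)"
  note IH = less.hyps[folded n_def]
  have card: "card I \<le> n" "finite I" if "I \<subseteq> verts G" for I
    using that card_mono[OF finite_verts] finite_subset[OF _ finite_verts] by (auto simp: n_def)
  \<comment> \<open>Either one of the two product identities applies, or the monomial is already in
    normal form.\<close>
  consider (X) v I where "v \<in># U" "I \<in># S" "v \<in> I"
    | (Y) I J where "I \<in># S" "J \<in># S" "\<not> I \<subseteq> J" "\<not> J \<subseteq> I"
    | (chain) "\<And>I J. I \<in># S \<Longrightarrow> J \<in># S \<Longrightarrow> I \<subseteq> J \<or> J \<subseteq> I" "\<And>I. I \<in># S \<Longrightarrow> I \<inter> set_mset U = {}"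
    by blast
  then show ?case
  proof cases
    case X
    obtain U' where U': "U = add_mset v U'" using X by (metis insert_DiffM)
    obtain S' where S': "S = add_mset I S'" using X by (metis insert_DiffM)
    have I: "I \<subseteq> verts G" using less.prems X by auto
    have smaller: "monomial G A W (add_mset K S') \<in> cluster_cone G A"
      if "K \<subset> I" "set_mset W \<subseteq> verts G" for K W
    proof (rule IH)
      have "K \<subseteq> verts G" using that I by auto
      then show "J \<subseteq> verts G" if "J \<in># add_mset K S'" for J
        using that less.prems S' by auto
      have "bulk n (card K) < bulk n (card I)"
        using that card[OF I] by (intro bulk_less psubset_card_mono) auto
      then show "(\<Sum>I\<in>#add_mset K S'. bulk n (card I)) < (\<Sum>I\<in>#S. bulk n (card I))"
        by (simp add: S')
    qed (rule that)
    \<comment> \<open>The untouched part of the monomial is a fixed factor inside \<open>Q\<close>.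
      Every new term has a proper subset of \<open>I\<close> in place of \<open>I\<close>, so the
      measure drops whatever variables appear.\<close>
    have "X v * Y G A I * monomial G A U' S' \<in> cluster_cone G A"
    proof (rule variable_mult_induct[where Q = "\<lambda>z. z * monomial G A U' S' \<in> cluster_cone G A"])
      show "finite I" by (rule card) fact
      fix u K assume K: "u \<in> I" "K \<subset> I"
      then have "lconst (A u) * monomial G A U' (add_mset K S') \<in> cluster_cone G A"
        using I less.prems by (intro cluster_cone_mult_var smaller) (auto simp: U')
      then show "(if u \<in> verts G then lconst (A u) else 0) * Y G A K * monomial G A U' S' \<in> cluster_cone G A"
        by (simp add: monomial_add_Y mult.assoc cluster_cone_0)
      fix w assume "u \<rightarrow>\<^bsub>G\<^esub> w"
      then have "monomial G A (add_mset w U') (add_mset K S') \<in> cluster_cone G A"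
        using K less.prems adj_in_verts by (intro smaller) (auto simp: U')
      then show "X w * Y G A K * monomial G A U' S' \<in> cluster_cone G A"
        by (simp add: monomial_add_Y monomial_add_X mult_ac)
    qed (use X in \<open>auto simp: distrib_right intro: cluster_cone_0 cluster_cone_add\<close>)
    then show ?thesis by (simp add: U' S' monomial_add_X monomial_add_Y mult_ac)
  next
    case Y
    obtain S0 where S0: "S = add_mset I S0" using Y by (metis insert_DiffM)
    moreover have "J \<in># S0" using Y S0 by auto
    ultimately obtain S' where S': "S = add_mset I (add_mset J S')" by (metis insert_DiffM)
    have IJ: "I \<subseteq> verts G" "J \<subseteq> verts G" "I \<union> J \<subseteq> verts G" using less.prems Y by auto
    \<comment> \<open>\<open>W\<close> stands for the support of a linkage. Deleting it cannot raise
      the measure, and already for empty \<open>W\<close> the drop is strict because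
      \<open>I\<close> and \<open>J\<close> are incomparable.\<close>
    have "(Y G A (I \<union> J - W) * Y G A (I \<inter> J - W)) * monomial G A U S' \<in> cluster_cone G A" for W
    proof -
      have "monomial G A U (add_mset (I \<union> J - W) (add_mset (I \<inter> J - W) S')) \<in> cluster_cone G A"
      proof (rule IH)
        have "bulk n (card (I \<union> J - W)) \<le> bulk n (card (I \<union> J))"
          using card[OF IJ(3)] by (intro bulk_mono card_mono) auto
        moreover have "bulk n (card (I \<inter> J - W)) \<le> bulk n (card (I \<inter> J))"
          using card[of "I \<inter> J"] IJ by (intro bulk_mono card_mono) auto
        moreover have "bulk n (card (I \<union> J)) + bulk n (card (I \<inter> J)) < bulk n (card I) + bulk n (card J)"
        proof (rule bulk_concave)
          show "card (I \<inter> J) < card I" "card I < card (I \<union> J)" "card J < card (I \<union> J)"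
            using Y card IJ by (auto intro!: psubset_card_mono)
        qed (use card IJ card_Un_Int[of I J] in auto)
        ultimately show "(\<Sum>I\<in>#add_mset (I \<union> J - W) (add_mset (I \<inter> J - W) S'). bulk n (card I)) <
            (\<Sum>I\<in>#S. bulk n (card I))"
          by (simp add: S')
      qed (use IJ less.prems S' in auto)
      then show ?thesis by (simp add: monomial_add_Y mult_ac)
    qed
    then have "Y G A I * Y G A J * monomial G A U S' \<in> cluster_cone G A"
      unfolding mult_eq_sum_linkages[OF card(2)[OF IJ(1)] card(2)[OF IJ(2)]] sum_distrib_right
      by (rule cluster_cone_sum)
    then show ?thesis by (simp add: S' monomial_add_Y mult_ac)
  next
    case chain
    then show ?thesis using less.prems by (intro cluster_cone_base cluster_monomial_chain) auto
  qed
qed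

end

theorem theorem1p3:
  fixes G :: "('v, 'e) pre_digraph"
    and A :: "'v \<Rightarrow> 'r::comm_ring_1"
    and U :: "'v multiset"
    and S :: "'v set multiset"
  assumes "bidirected_tree G"
    and "alg_independent_over_int (verts G) A"
    and "set_mset U \<subseteq> verts G"
    and "\<forall>I\<in>#S. I \<subseteq> verts G"
  shows "\<exists>C c. finite C \<and> C \<subseteq> cluster_monomials G A \<and>
           (\<forall>m\<in>C. nonneg_coeff (verts G) A (c m)) \<and>
           monomial G A U S = (\<Sum>m\<in>C. lconst (c m) * m)"
proof -
  interpret bidirected_tree_algebra G A by unfold_locales (rule assms(1))
  show ?thesis using monomial_in_cluster_cone[of U S] assms(3,4) by (simp add: cluster_cone_def)
qed

end
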